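(* Let $Y$ be a locally compact Hausdorff space. Every (non-zero) closed subalgebra of $C_0(Y,\mathbb{C})$ has the complex Mazur-Ulam property. In particular, every uniform algebra has the complex Mazur-Ulam property.
   Context: $C_0(Y,\mathbb{C})$ is the algebra of complex continuous functions on $Y$ vanishing at infinity with the supremum norm; closed means uniformly closed. A uniform algebra on a compact Hausdorff space $X$ is a closed subalgebra of $C(X,\mathbb{C})$ which contains the constants and separates the points of $X$. A complex Banach space $B$ has the complex Mazur-Ulam property if for any complex Banach space $B'$, every surjective isometry from the unit sphere of $B$ onto the unit sphere of $B'$ admits an extension to a surjective real-linear isometry from $B$ onto $B'$. *)

theory Defs
  imports "HOL-Analysis.Analysis"
begin

section \<open>Complex normed spaces\<close>

class complex_normed_vector = real_normed_vector +
  fixes scaleC :: "complex \<Rightarrow> 'a \<Rightarrow> 'a"  (infixr \<open>*\<^sub>C\<close> 75)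
  assumes scaleC_add_right: "a *\<^sub>C (x + y) = a *\<^sub>C x + a *\<^sub>C y"
    and scaleC_add_left: "(a + b) *\<^sub>C x = a *\<^sub>C x + b *\<^sub>C x"
    and scaleC_scaleC: "a *\<^sub>C b *\<^sub>C x = (a * b) *\<^sub>C x"
    and scaleR_scaleC: "r *\<^sub>R x = complex_of_real r *\<^sub>C x"
    and norm_scaleC: "norm (a *\<^sub>C x) = cmod a * norm x"

lemma scaleC_one: "1 *\<^sub>C x = (x :: 'a::complex_normed_vector)"
  using scaleR_scaleC[of 1 x] by simp

global_interpretation complex_vector:
  vector_space "scaleC :: complex \<Rightarrow> 'a \<Rightarrow> 'a::complex_normed_vector"
  by unfold_locales (simp_all add: scaleC_add_right scaleC_add_left scaleC_scaleC scaleC_one)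

text \<open>
  Complex Banach spaces are presented as the complete complex-linear subspaces of the types of
  class \<^class>\<open>complex_normed_vector\<close>. A Banach space that is a whole type is the case \<^term>\<open>UNIV\<close>.
\<close>

definition complex_banach_space :: "'a::complex_normed_vector set \<Rightarrow> bool" where
  "complex_banach_space B \<longleftrightarrow> complex_vector.subspace B \<and> complete B"


section \<open>The complex Mazur-Ulam property\<close>

definition surj_isometry :: "'a::metric_space set \<Rightarrow> 'b::metric_space set \<Rightarrow> ('a \<Rightarrow> 'b) \<Rightarrow> bool" where
  "surj_isometry S S' f \<longleftrightarrow> f ` S = S' \<and> (\<forall>x\<in>S. \<forall>y\<in>S. dist (f x) (f y) = dist x y)"

definition real_linear_on :: "'a::real_vector set \<Rightarrow> ('a \<Rightarrow> 'b::real_vector) \<Rightarrow> bool" where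
  "real_linear_on B f \<longleftrightarrow>
     (\<forall>x\<in>B. \<forall>y\<in>B. f (x + y) = f x + f y) \<and> (\<forall>r. \<forall>x\<in>B. f (r *\<^sub>R x) = r *\<^sub>R f x)"

definition unit_sphere :: "'a::real_normed_vector set \<Rightarrow> 'a set" where
  "unit_sphere B = {x \<in> B. norm x = 1}"

text \<open>
  HOL has no quantification over types inside a formula. The type in which the second Banach
  space \<open>B'\<close> lives is therefore a parameter, and \<open>B\<close> has the complex Mazur-Ulam property if
  \<open>complex_mazur_ulam TYPE('b) B\<close> holds for every type \<open>'b\<close>, that is, with \<open>'b\<close> a free
  type variable of the theorem.
\<close>

definition complex_mazur_ulam ::
  "'b::complex_normed_vector itself \<Rightarrow> 'a::complex_normed_vector set \<Rightarrow> bool" where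
  "complex_mazur_ulam (_ :: 'b itself) B \<longleftrightarrow>
     complex_banach_space B \<and>
     (\<forall>(B' :: 'b set) (T :: 'a \<Rightarrow> 'b).
        complex_banach_space B' \<longrightarrow> surj_isometry (unit_sphere B) (unit_sphere B') T \<longrightarrow>
        (\<exists>U :: 'a \<Rightarrow> 'b. real_linear_on B U \<and> surj_isometry B B' U \<and>
                        (\<forall>x\<in>unit_sphere B. U x = T x)))"


section \<open>Algebras of continuous functions\<close>

instantiation complex :: complex_normed_vector
begin

definition scaleC_complex :: "complex \<Rightarrow> complex \<Rightarrow> complex" where
  "scaleC_complex = (*)"

instance
  by standard (simp_all add: scaleC_complex_def algebra_simps norm_mult scaleR_conv_of_real)

end

instantiation bcontfun :: (topological_space, complex_normed_vector) complex_normed_vector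
begin

context
  includes bcontfun.lifting
begin

lift_definition scaleC_bcontfun :: "complex \<Rightarrow> ('a \<Rightarrow>\<^sub>C 'b) \<Rightarrow> 'a \<Rightarrow>\<^sub>C 'b" is
  "\<lambda>c f x. c *\<^sub>C f x"
  proof -
    fix c :: complex and f :: "'a \<Rightarrow> 'b"
    assume "f \<in> bcontfun"
    then have cont: "continuous_on UNIV f" and "bounded (range f)"
      by (auto simp: bcontfun_def)
    have lin: "bounded_linear (\<lambda>x :: 'b. c *\<^sub>C x)"
      by (rule bounded_linear_intro[where K = "cmod c"])
         (simp_all add: scaleC_add_right scaleR_scaleC scaleC_scaleC norm_scaleC mult.commute)
    have "bounded (range (\<lambda>x. c *\<^sub>C f x))"
      using bounded_linear_image[OF \<open>bounded (range f)\<close> lin] by (simp add: image_image)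
    with bounded_linear.continuous_on[OF lin cont] show "(\<lambda>x. c *\<^sub>C f x) \<in> bcontfun"
      by (simp add: bcontfun_def)
  qed

end

instance
  proof
    fix a b :: complex and r :: real and f g :: "'a \<Rightarrow>\<^sub>C 'b"
    note [simp] = scaleC_bcontfun.rep_eq
    show "a *\<^sub>C (f + g) = a *\<^sub>C f + a *\<^sub>C g"
      by (rule bcontfun_eqI) (simp add: scaleC_add_right)
    show "(a + b) *\<^sub>C f = a *\<^sub>C f + b *\<^sub>C f"
      by (rule bcontfun_eqI) (simp add: scaleC_add_left)
    show ass: "a *\<^sub>C b *\<^sub>C f = (a * b) *\<^sub>C f" for a b and f :: "'a \<Rightarrow>\<^sub>C 'b"
      by (rule bcontfun_eqI) (simp add: scaleC_scaleC)
    show "r *\<^sub>R f = complex_of_real r *\<^sub>C f"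
      by (rule bcontfun_eqI) (simp add: scaleR_scaleC)
    have le: "norm (a *\<^sub>C f) \<le> cmod a * norm f" for a and f :: "'a \<Rightarrow>\<^sub>C 'b"
      by (rule norm_bound) (simp add: norm_scaleC norm_bounded mult_left_mono)
    show "norm (a *\<^sub>C f) = cmod a * norm f"
    proof (cases "a = 0")
      case True
      then show ?thesis using le[of a f] by simp
    next
      case False
      have "inverse a *\<^sub>C a *\<^sub>C f = f"
        using False by (intro bcontfun_eqI) (simp add: scaleC_scaleC scaleC_one)
      then have "norm f \<le> inverse (cmod a) * norm (a *\<^sub>C f)"
        using le[of "inverse a" "a *\<^sub>C f"] by (simp add: norm_inverse)
      then have "cmod a * norm f \<le> norm (a *\<^sub>C f)"
        using False by (simp add: field_simps)
      with le[of a f] show ?thesis by simp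
    qed
  qed

end

instantiation bcontfun :: (topological_space, real_normed_algebra) times
begin

context
  includes bcontfun.lifting
begin

lift_definition times_bcontfun :: "('a \<Rightarrow>\<^sub>C 'b) \<Rightarrow> ('a \<Rightarrow>\<^sub>C 'b) \<Rightarrow> 'a \<Rightarrow>\<^sub>C 'b" is
  "\<lambda>f g x. f x * g x"
  proof -
    fix f g :: "'a \<Rightarrow> 'b"
    assume "f \<in> bcontfun" "g \<in> bcontfun"
    then have cont: "continuous_on UNIV f" "continuous_on UNIV g"
      and "bounded (range f)" "bounded (range g)"
      by (auto simp: bcontfun_def)
    then obtain K L where K: "\<And>x. norm (f x) \<le> K" and L: "\<And>x. norm (g x) \<le> L"
      by (auto simp: bounded_iff)
    show "(\<lambda>x. f x * g x) \<in> bcontfun"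
    proof (rule bcontfun_normI)
      show "continuous_on UNIV (\<lambda>x. f x * g x)"
        using cont by (rule continuous_on_mult)
      show "norm (f x * g x) \<le> K * L" for x
        using norm_mult_ineq[of "f x" "g x"] mult_mono'[OF K L norm_ge_zero norm_ge_zero]
        by (rule order_trans)
    qed
  qed

end

instance ..

end

definition C0 :: "('y::topological_space \<Rightarrow>\<^sub>C complex) set" where
  "C0 = {f. \<forall>e>0. compact {y. e \<le> cmod (apply_bcontfun f y)}}"

definition complex_subalgebra :: "('y::topological_space \<Rightarrow>\<^sub>C complex) set \<Rightarrow> bool" where
  "complex_subalgebra A \<longleftrightarrow> complex_vector.subspace A \<and> (\<forall>f\<in>A. \<forall>g\<in>A. f * g \<in> A)"

text \<open>On a compact space every continuous function is bounded, so \<open>C(X)\<close> is all of \<open>'x \<Rightarrow>\<^sub>C complex\<close>.\<close>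

definition uniform_algebra :: "('x::t2_space \<Rightarrow>\<^sub>C complex) set \<Rightarrow> bool" where
  "uniform_algebra A \<longleftrightarrow>
     compact (UNIV :: 'x set) \<and> complex_subalgebra A \<and> closed A \<and>
     (\<forall>c. const_bcontfun c \<in> A) \<and>
     (\<forall>x y. x \<noteq> y \<longrightarrow> (\<exists>f\<in>A. apply_bcontfun f x \<noteq> apply_bcontfun f y))"

end

theory Submission
  imports Defs
begin

text \<open>
  Let \<open>A\<close> be the algebra and \<open>T\<close> a surjective isometry from its unit sphere onto that of \<open>B'\<close>.
  The extension has to be \<open>f \<mapsto> \<parallel>f\<parallel> T (f / \<parallel>f\<parallel>)\<close>, and the task is to see that this map is additive.
  For this it is enough to have a family of sublinear functionals on \<open>B'\<close> which is norming and whose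
  values at \<open>T f\<close> and \<open>- T f\<close> are opposite real-linear expressions in \<open>f\<close>.
  
  The functionals come from the maximal convex subsets of the two spheres, which \<open>T\<close> matches up with
  each other (\<open>maximal_face_image\<close>). On the side of \<open>A\<close>, compactness shows that each of them consists
  of all \<open>f\<close> in the sphere with \<open>f x = l\<close>, for some point \<open>x\<close> and some unimodular \<open>l\<close>
  (\<open>maximal_face_eq_face\<close>). The points that occur form a boundary of \<open>A\<close>, and they behave like the
  points of the Choquet boundary of a uniform algebra: \<open>A\<close> contains functions peaking at \<open>x\<close>
  (\<open>localized_peaking_function\<close>), because a function that is bounded by 1 on the common peak set of
  a face extends from there to an element of the unit ball (\<open>extension_from_peak_set\<close>). By means of
  such functions a value \<open>f x = r l\<close> with \<open>r\<close> in \<open>[-1, 1]\<close> is encoded in distances: \<open>f\<close> is at distance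
  \<open>1 - r\<close> from the face of \<open>(x, l)\<close> and \<open>1 + r\<close> from the face of \<open>(x, - l)\<close> (\<open>distance_to_face\<close>).
  
  On the side of \<open>B'\<close>, let \<open>D\<close> be the image of the face of \<open>(x, 1)\<close>. Its complex rotations \<open>\<kappa> D\<close> are again
  maximal convex subsets, so \<open>T\<close> pulls them back to faces of \<open>A\<close>. For \<open>\<kappa>\<close> near 1 they sit at
  the same point \<open>x\<close>, since faces at different points are too far apart; by iteration this holds
  for every \<open>\<kappa>\<close>. The face that corresponds to \<open>\<kappa> D\<close> is that of \<open>(x, \<nu>)\<close>, where \<open>\<kappa> \<mapsto> \<nu>\<close> is an isometry of the
  circle that fixes 1, so that \<open>\<nu>\<close> is \<open>\<kappa>\<close> or its conjugate (\<open>face_rotation\<close>). In either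
  case \<open>\<nu>\<close> and \<open>\<kappa>\<close> have the same real part. The distances above, transported by \<open>T\<close>, then force
  the functional of \<open>D\<close> to take the value \<open>Re (f x)\<close> at \<open>T f\<close> (\<open>gauge_at_image\<close>).
\<close>


section \<open>Maximal convex subsets of the unit sphere\<close>

definition maximal_face :: "'a::real_normed_vector set \<Rightarrow> 'a set \<Rightarrow> bool" where
  "maximal_face B C \<longleftrightarrow> C \<noteq> {} \<and> C \<subseteq> unit_sphere B \<and> convex C \<and>
     (\<forall>C'. C \<subseteq> C' \<longrightarrow> C' \<subseteq> unit_sphere B \<longrightarrow> convex C' \<longrightarrow> C' = C)"

lemma maximal_faceD:
  assumes "maximal_face B C"
  shows "C \<noteq> {}" "C \<subseteq> unit_sphere B" "convex C"
    "\<And>C'. C \<subseteq> C' \<Longrightarrow> C' \<subseteq> unit_sphere B \<Longrightarrow> convex C' \<Longrightarrow> C' = C"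
  using assms unfolding maximal_face_def by blast+

lemma maximal_face_norm: "maximal_face B C \<Longrightarrow> x \<in> C \<Longrightarrow> norm x = 1"
  using maximal_faceD(2) unfolding unit_sphere_def by blast

lemma convex_subset_maximal_face:
  assumes "C \<noteq> {}" "C \<subseteq> unit_sphere B" "convex C"
  obtains D where "maximal_face B D" "C \<subseteq> D"
proof -
  define F where "F = {D. C \<subseteq> D \<and> D \<subseteq> unit_sphere B \<and> convex D}"
  have "\<exists>M\<in>F. \<forall>X\<in>F. M \<subseteq> X \<longrightarrow> X = M"
  proof (rule subset_Zorn_nonempty)
    show "F \<noteq> {}"
      using assms by (auto simp: F_def)
    show "\<Union>\<C> \<in> F" if "\<C> \<noteq> {}" and ch: "subset.chain F \<C>" for \<C>
    proof -
      have sub: "\<C> \<subseteq> F" and lin: "\<And>X Y. X \<in> \<C> \<Longrightarrow> Y \<in> \<C> \<Longrightarrow> X \<subseteq> Y \<or> Y \<subseteq> X"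
        using ch by (auto simp: subset_chain_def)
      have "convex (\<Union>\<C>)"
      proof (rule convexI)
        fix x y and u v :: real
        assume "x \<in> \<Union>\<C>" "y \<in> \<Union>\<C>" and uv: "0 \<le> u" "0 \<le> v" "u + v = 1"
        then obtain X Y where "X \<in> \<C>" "Y \<in> \<C>" "x \<in> X" "y \<in> Y"
          by blast
        with lin obtain Z where "Z \<in> \<C>" "x \<in> Z" "y \<in> Z"
          by blast
        moreover have "convex Z"
          using sub \<open>Z \<in> \<C>\<close> by (auto simp: F_def)
        ultimately show "u *\<^sub>R x + v *\<^sub>R y \<in> \<Union>\<C>"
          using uv convexD by blast
      qed
      then show ?thesis
        using that(1) sub by (auto simp: F_def)
    qed
  qed
  then obtain M where "M \<in> F" and max: "\<And>X. X \<in> F \<Longrightarrow> M \<subseteq> X \<Longrightarrow> X = M"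
    by blast
  then have "maximal_face B M"
    using assms(1) max \<open>M \<in> F\<close> unfolding maximal_face_def F_def
    by (auto dest: subset_trans)
  then show ?thesis
    using that \<open>M \<in> F\<close> by (auto simp: F_def)
qed

lemma norm_convex_comb_eq_1:
  fixes x y :: "'a::real_normed_vector"
  assumes "norm x = 1" "norm y = 1" "norm (x + y) = 2" "0 \<le> u" "0 \<le> v" "u + v = 1"
  shows "norm (u *\<^sub>R x + v *\<^sub>R y) = 1"
proof (rule antisym)
  show "norm (u *\<^sub>R x + v *\<^sub>R y) \<le> 1"
    using assms norm_triangle_ineq[of "u *\<^sub>R x" "v *\<^sub>R y"] by simp
  have swapped: "1 \<le> norm (a *\<^sub>R p + b *\<^sub>R q)"
    if "norm p = 1" "norm (p + q) = 2" "0 \<le> a" "a \<le> b" "a + b = 1" for p q :: 'a and a b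
  proof -
    have "b *\<^sub>R (p + q) = (a *\<^sub>R p + b *\<^sub>R q) + (b - a) *\<^sub>R p"
      by (simp add: algebra_simps)
    then have "norm (b *\<^sub>R (p + q)) \<le> norm (a *\<^sub>R p + b *\<^sub>R q) + norm ((b - a) *\<^sub>R p)"
      by (metis norm_triangle_ineq)
    moreover have "norm (b *\<^sub>R (p + q)) = b * 2" "norm ((b - a) *\<^sub>R p) = b - a"
      using that by (simp_all del: scaleR_add_right)
    ultimately show ?thesis
      using that by linarith
  qed
  show "1 \<le> norm (u *\<^sub>R x + v *\<^sub>R y)"
    using swapped[of x y u v] swapped[of y x v u] assms by (cases "u \<le> v") (auto simp: add.commute)
qed

text \<open>
  Two unit vectors at distance 2 from each other's negatives span a segment in the sphere. As \<open>C\<close> is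
  convex, the hull of \<open>C\<close> and \<open>y\<close> is the union of the segments from \<open>y\<close> to points of \<open>C\<close>.
\<close>

lemma convex_insert_in_sphere:
  assumes B: "subspace B" and C: "C \<subseteq> unit_sphere B" "convex C"
    and y: "y \<in> unit_sphere B" and far: "\<And>z. z \<in> C \<Longrightarrow> norm (y + z) = 2"
  shows "convex hull (insert y C) \<subseteq> unit_sphere B"
proof (cases "C = {}")
  case True
  then show ?thesis
    using y by simp
next
  case False
  have "u *\<^sub>R y + v *\<^sub>R z \<in> unit_sphere B"
    if "0 \<le> u" "0 \<le> v" "u + v = 1" "z \<in> C" for u v z
  proof -
    have "z \<in> unit_sphere B"
      using C that by blast
    then show ?thesis
      using that far[of z] y B norm_convex_comb_eq_1[of y z u v]
      by (auto simp: unit_sphere_def subspace_add subspace_scale)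
  qed
  then show ?thesis
    using False \<open>convex C\<close> by (auto simp: convex_hull_insert convex_hull_eq[THEN iffD2])
qed

text \<open>
  Membership in a maximal face is a condition on distances alone, namely on the distances between \<open>y\<close>
  and the negatives of the members. This is what makes these sets accessible to isometries.
\<close>

lemma maximal_face_membership:
  assumes "subspace B" "maximal_face B C" "y \<in> unit_sphere B"
    and "\<And>z. z \<in> C \<Longrightarrow> norm (y + z) = 2"
  shows "y \<in> C"
proof -
  have "convex hull (insert y C) = C"
    using convex_insert_in_sphere[of B C y] assms maximal_faceD[OF assms(2)]
    by (meson convex_convex_hull hull_subset insert_subset)
  then show ?thesis
    by (metis hull_inc insertI1)
qed

lemma convex_in_sphere_norm_add:
  assumes "C \<subseteq> unit_sphere B" "convex C" "x \<in> C" "y \<in> C" "0 \<le> a" "0 \<le> b"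
  shows "norm (a *\<^sub>R x + b *\<^sub>R y) = a + b"
proof (cases "a + b = 0")
  case True
  then show ?thesis
    using assms by (simp add: add_nonneg_eq_0_iff)
next
  case False
  have "(a / (a + b)) *\<^sub>R x + (b / (a + b)) *\<^sub>R y \<in> C"
    using assms False by (intro convexD) (auto simp: add_divide_distrib[symmetric])
  then have "norm ((a / (a + b)) *\<^sub>R x + (b / (a + b)) *\<^sub>R y) = 1"
    using assms(1) by (auto simp: unit_sphere_def)
  moreover have "a *\<^sub>R x + b *\<^sub>R y = (a + b) *\<^sub>R ((a / (a + b)) *\<^sub>R x + (b / (a + b)) *\<^sub>R y)"
    using False by (simp add: scaleR_add_right)
  ultimately show ?thesis
    using assms by simp
qed

lemma maximal_face_norm_add:
  assumes "maximal_face B C" "x \<in> C" "y \<in> C" "0 \<le> a" "0 \<le> b"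
  shows "norm (a *\<^sub>R x + b *\<^sub>R y) = a + b"
  using maximal_faceD(2,3)[OF assms(1)] assms(2-5) by (rule convex_in_sphere_norm_add)

section \<open>Isometries preserve maximal convex subsets\<close>

lemma surj_isometry_dist:
  "surj_isometry S S' T \<Longrightarrow> x \<in> S \<Longrightarrow> y \<in> S \<Longrightarrow> dist (T x) (T y) = dist x y"
  by (simp add: surj_isometry_def)

lemma surj_isometry_image: "surj_isometry S S' T \<Longrightarrow> T ` S = S'"
  by (simp add: surj_isometry_def)

lemma surj_isometry_inj:
  assumes "surj_isometry S S' T"
  shows "inj_on T S"
proof (rule inj_onI)
  fix x y assume "x \<in> S" "y \<in> S" "T x = T y"
  then show "x = y"
    using surj_isometry_dist[OF assms, of x y] by simp
qed

lemma surj_isometry_inv: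
  assumes "surj_isometry S S' T"
  shows "surj_isometry S' S (inv_into S T)"
  unfolding surj_isometry_def
proof (intro conjI ballI)
  have "bij_betw T S S'"
    using surj_isometry_inj[OF assms] surj_isometry_image[OF assms] by (rule bij_betw_imageI)
  then show "inv_into S T ` S' = S"
    by (rule bij_betw_imp_surj_on[OF bij_betw_inv_into])
  fix x y assume "x \<in> S'" "y \<in> S'"
  then have xy: "x \<in> T ` S" "y \<in> T ` S"
    unfolding surj_isometry_image[OF assms] by blast+
  show "dist (inv_into S T x) (inv_into S T y) = dist x y"
    using surj_isometry_dist[OF assms inv_into_into[OF xy(1)] inv_into_into[OF xy(2)]]
    unfolding f_inv_into_f[OF xy(1)] f_inv_into_f[OF xy(2)] by (rule sym)
qed

lemma surj_isometry_comp:
  assumes "surj_isometry S S' f" "surj_isometry S' S'' g"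
  shows "surj_isometry S S'' (g \<circ> f)"
  using assms by (auto simp: surj_isometry_def image_comp)

lemma unit_sphere_minus: "subspace B \<Longrightarrow> x \<in> unit_sphere B \<Longrightarrow> - x \<in> unit_sphere B"
  by (simp add: unit_sphere_def subspace_neg)

text \<open>
  Let \<open>z\<close> be the average of \<open>X\<close> and \<open>D\<close> any maximal face that contains \<open>T z\<close>. A vector \<open>d\<close> of \<open>D\<close> has distance 2
  from \<open>- T z\<close>, so the vector \<open>v\<close> with \<open>T v = - d\<close> has distance 2 from \<open>z\<close>. It then has distance 2 from each
  member \<open>x\<close> of \<open>X\<close>, since 2 is the largest distance possible and \<open>z\<close> is the average. Going forward again, \<open>T x\<close>
  has distance 2 from all of \<open>- D\<close>, and this characterises membership in \<open>D\<close>.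
\<close>

lemma finite_image_in_maximal_face:
  fixes T :: "'a::real_normed_vector \<Rightarrow> 'b::real_normed_vector"
  assumes B: "subspace B" and B': "subspace B'"
    and T: "surj_isometry (unit_sphere B) (unit_sphere B') T"
    and C: "C \<subseteq> unit_sphere B" "convex C"
    and X: "finite X" "X \<subseteq> C" "X \<noteq> {}"
  obtains D where "maximal_face B' D" "T ` X \<subseteq> D"
proof -
  let ?S = "unit_sphere B" and ?S' = "unit_sphere B'"
  have TS: "T x \<in> ?S'" if "x \<in> ?S" for x
    using T that by (auto simp: surj_isometry_def)
  define z where "z = (\<Sum>x\<in>X. (1 / card X) *\<^sub>R x)"
  have "z \<in> C"
    unfolding z_def using X C(2)
    by (intro convex_sum) auto
  then have zS: "z \<in> ?S" "norm z = 1"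
    using C by (auto simp: unit_sphere_def)
  have near: "norm (v + x) = 2" if v: "v \<in> ?S" "norm (v + z) = 2" and x: "x \<in> X" for v x
  proof (rule antisym)
    have n1: "norm v = 1" "\<And>x. x \<in> X \<Longrightarrow> norm x = 1"
      using v X C by (auto simp: unit_sphere_def)
    then have le2: "norm (v + y) \<le> 2" if "y \<in> X" for y
      using norm_triangle_ineq[of v y] that by simp
    then show "norm (v + x) \<le> 2"
      using x .
    have "real (card X) *\<^sub>R (v + z) = (\<Sum>y\<in>X. v + y)"
      using X by (simp add: z_def sum.distrib sum_constant_scaleR scaleR_add_right flip: scaleR_right.sum)
    also have "\<dots> = (v + x) + (\<Sum>y\<in>X - {x}. v + y)"
      using X x by (simp add: sum.remove)
    finally have "real (card X) * norm (v + z) \<le> norm (v + x) + norm (\<Sum>y\<in>X - {x}. v + y)"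
      by (metis abs_of_nat norm_scaleR norm_triangle_ineq)
    also have "norm (\<Sum>y\<in>X - {x}. v + y) \<le> real (card (X - {x})) * 2"
      using le2 by (intro sum_norm_bound) auto
    also have "real (card (X - {x})) = real (card X) - 1"
      using X x by (simp add: card_Diff_singleton of_nat_diff Suc_le_eq card_gt_0_iff)
    finally show "2 \<le> norm (v + x)"
      using v by (simp add: algebra_simps)
  qed
  have "{T z} \<noteq> {}" "{T z} \<subseteq> ?S'" "convex {T z}"
    using TS[OF zS(1)] by auto
  then obtain D where D: "maximal_face B' D" "{T z} \<subseteq> D"
    by (rule convex_subset_maximal_face)
  then have "T z \<in> D"
    by blast
  have "T x \<in> D" if x: "x \<in> X" for x
  proof (rule maximal_face_membership[OF B' D(1)])
    have xS: "x \<in> ?S"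
      using x X C by blast
    then show "T x \<in> ?S'"
      by (rule TS)
    fix d assume d: "d \<in> D"
    then have dS: "- d \<in> ?S'"
      using maximal_faceD(2)[OF D(1)] B' by (auto intro: unit_sphere_minus)
    then have "- d \<in> T ` ?S"
      using T by (simp add: surj_isometry_def)
    then obtain v where v: "v \<in> ?S" "T v = - d"
      by (metis imageE)
    have "norm (- v + z) = dist z v"
      by (simp add: dist_norm)
    also have "\<dots> = dist (T z) (T v)"
      using surj_isometry_dist[OF T zS(1) v(1)] by simp
    also have "\<dots> = 2"
      using maximal_face_norm_add[OF D(1) \<open>T z \<in> D\<close> d, of 1 1] v by (simp add: dist_norm)
    finally have "norm (- v + x) = 2"
      using near[of "- v" x] v x B by (simp add: unit_sphere_minus)
    then have "dist (T x) (T v) = 2"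
      using surj_isometry_dist[OF T xS v(1)] by (simp add: dist_norm)
    then show "norm (T x + d) = 2"
      using v by (simp add: dist_norm)
  qed
  then show ?thesis
    using that D(1) by blast
qed

text \<open>
  A convex combination involves only finitely many points, so the hull of the image stays in the sphere.
\<close>

lemma convex_image_in_maximal_face:
  fixes T :: "'a::real_normed_vector \<Rightarrow> 'b::real_normed_vector"
  assumes B: "subspace B" and B': "subspace B'"
    and T: "surj_isometry (unit_sphere B) (unit_sphere B') T"
    and C: "C \<subseteq> unit_sphere B" "convex C" "C \<noteq> {}"
  obtains D where "maximal_face B' D" "T ` C \<subseteq> D"
proof -
  have sub: "convex hull (T ` C) \<subseteq> unit_sphere B'"
  proof
    fix b assume "b \<in> convex hull (T ` C)"
    then obtain S u where S: "finite S" "S \<subseteq> T ` C" "\<forall>x\<in>S. 0 \<le> u x" "sum u S = 1"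
      and b: "(\<Sum>v\<in>S. u v *\<^sub>R v) = b"
      unfolding convex_hull_explicit mem_Collect_eq by (elim exE conjE)
    obtain X where X: "X \<subseteq> C" "finite X" "S = T ` X"
      using finite_subset_image[OF S(1,2)] by (elim exE conjE)
    have "X \<noteq> {}"
    proof
      assume "X = {}"
      then show False
        using S(4) X(3) by simp
    qed
    obtain D where D: "maximal_face B' D" "T ` X \<subseteq> D"
      by (rule finite_image_in_maximal_face[OF B B' T C(1,2) X(2,1) \<open>X \<noteq> {}\<close>])
    have "u v *\<^sub>R v = u v *\<^sub>R v \<and> v \<in> D" if "v \<in> S" for v
      using that D(2) X(3) by blast
    then have "(\<Sum>v\<in>S. u v *\<^sub>R v) \<in> D"
      using S by (intro convex_sum maximal_faceD(3)[OF D(1)]) simp_all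
    then show "b \<in> unit_sphere B'"
      unfolding b using maximal_faceD(2)[OF D(1)] by (rule subsetD[rotated])
  qed
  have "convex hull (T ` C) \<noteq> {}"
    using C(3) by simp
  then obtain D where D: "maximal_face B' D" "convex hull (T ` C) \<subseteq> D"
    using sub by (rule convex_subset_maximal_face[OF _ _ convex_convex_hull])
  show ?thesis
    using D(1) subset_trans[OF hull_subset D(2)] by (rule that)
qed

text \<open>
  The image lies in a maximal face \<open>D\<close>, and the preimage of \<open>D\<close> lies in a maximal face, too. The
  latter contains \<open>C\<close>, hence equals it.
\<close>

theorem maximal_face_image:
  fixes T :: "'a::real_normed_vector \<Rightarrow> 'b::real_normed_vector"
  assumes B: "subspace B" and B': "subspace B'"
    and T: "surj_isometry (unit_sphere B) (unit_sphere B') T"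
    and C: "maximal_face B C"
  shows "maximal_face B' (T ` C)"
proof -
  let ?S = "unit_sphere B" and ?S' = "unit_sphere B'"
  note Cf = maximal_faceD[OF C]
  obtain D where D: "maximal_face B' D" "T ` C \<subseteq> D"
    using convex_image_in_maximal_face[OF B B' T Cf(2,3,1)] .
  note Df = maximal_faceD[OF D(1)]
  obtain E where E: "maximal_face B E" "inv_into ?S T ` D \<subseteq> E"
    using convex_image_in_maximal_face[OF B' B surj_isometry_inv[OF T] Df(2,3,1)] .
  note Ef = maximal_faceD[OF E(1)]
  have inv: "inv_into ?S T (T x) = x" if "x \<in> ?S" for x
    using surj_isometry_inj[OF T] that by simp
  have "C \<subseteq> inv_into ?S T ` D"
  proof
    fix x assume "x \<in> C"
    then have "x = inv_into ?S T (T x)" "T x \<in> D"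
      using inv Cf(2) D(2) by auto
    then show "x \<in> inv_into ?S T ` D"
      by blast
  qed
  then have "C \<subseteq> E"
    using E(2) by (rule subset_trans)
  then have "E = C"
    using Cf(4) Ef(2,3) by blast
  have "D \<subseteq> T ` C"
  proof
    fix d assume d: "d \<in> D"
    then have "T (inv_into ?S T d) = d"
      using Df(2) T by (intro f_inv_into_f) (auto simp: surj_isometry_def)
    moreover have "inv_into ?S T d \<in> C"
      using E(2) d \<open>E = C\<close> by blast
    ultimately show "d \<in> T ` C"
      by (metis imageI)
  qed
  with D(2) have "T ` C = D"
    by (rule subset_antisym)
  with D(1) show ?thesis
    by (simp only:)
qed

lemma complex_subspace_imp_subspace:
  fixes B :: "'a::complex_normed_vector set"
  assumes "complex_vector.subspace B"
  shows "subspace B"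
  using complex_vector.subspace_0[OF assms] complex_vector.subspace_add[OF assms]
    complex_vector.subspace_scale[OF assms]
  by (intro subspaceI) (auto simp: scaleR_scaleC)

lemma norm_scaleC_diff: "norm (c *\<^sub>C x - c *\<^sub>C y) = cmod c * norm (x - y)"
  by (simp add: norm_scaleC flip: complex_vector.scale_right_diff_distrib)

lemma scaleC_surj_isometry:
  fixes B :: "'a::complex_normed_vector set"
  assumes B: "complex_vector.subspace B" and c: "cmod c = 1"
  shows "surj_isometry (unit_sphere B) (unit_sphere B) (scaleC c)"
  unfolding surj_isometry_def
proof (intro conjI ballI)
  have in_sphere: "k *\<^sub>C x \<in> unit_sphere B" if "x \<in> unit_sphere B" "cmod k = 1" for x k
    using that complex_vector.subspace_scale[OF B] by (simp add: unit_sphere_def norm_scaleC)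
  have c0: "c \<noteq> 0"
    using c by auto
  have "x \<in> scaleC c ` unit_sphere B" if "x \<in> unit_sphere B" for x
  proof (rule image_eqI)
    show "x = c *\<^sub>C (inverse c *\<^sub>C x)"
      using c0 by (simp add: scaleC_scaleC scaleC_one)
    show "inverse c *\<^sub>C x \<in> unit_sphere B"
      using that c by (intro in_sphere) (auto simp: norm_inverse)
  qed
  then show "scaleC c ` unit_sphere B = unit_sphere B"
    using in_sphere c by blast
  show "dist (c *\<^sub>C x) (c *\<^sub>C y) = dist x y" for x y
    using c by (simp add: dist_norm norm_scaleC_diff)
qed

lemma maximal_face_scaleC:
  fixes B :: "'a::complex_normed_vector set"
  assumes "complex_vector.subspace B" "cmod c = 1" "maximal_face B C"
  shows "maximal_face B (scaleC c ` C)"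
  using maximal_face_image[OF _ _ scaleC_surj_isometry] complex_subspace_imp_subspace assms by blast

section \<open>Sublinear support functionals of faces\<close>

locale sphere_face =
  fixes D :: "'a::real_normed_vector set"
  assumes nonempty: "D \<noteq> {}" and norm_eq_1: "d \<in> D \<Longrightarrow> norm d = 1" and convex_D: "convex D"
begin

text \<open>
  A functional of norm 1 that equals 1 on \<open>D\<close> could be had from the Hahn-Banach theorem. The largest
  sublinear functional below the norm that takes the value \<open>-1\<close> on \<open>- D\<close>, given by an explicit formula,
  serves as well: it turns out to be additive on the vectors where this matters.
\<close>

definition gauge_at :: "'a \<Rightarrow> real" where
  "gauge_at b = (INF (s, d) \<in> {0..} \<times> D. norm (b + s *\<^sub>R d) - s)"

lemma gauge_at_bdd_below: "bdd_below ((\<lambda>(s, d). norm (b + s *\<^sub>R d) - s) ` ({0..} \<times> D))"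
proof (rule bdd_belowI2[where m = "- norm b"])
  fix p assume "p \<in> {0::real..} \<times> D"
  then obtain s d where p: "p = (s, d)" "0 \<le> s" "d \<in> D"
    by auto
  have "norm (s *\<^sub>R d) \<le> norm (b + s *\<^sub>R d) + norm b"
    using norm_triangle_ineq4[of "b + s *\<^sub>R d" b] by simp
  then show "- norm b \<le> (case p of (s, d) \<Rightarrow> norm (b + s *\<^sub>R d) - s)"
    using p norm_eq_1 by simp
qed

lemma gauge_at_le: "0 \<le> s \<Longrightarrow> d \<in> D \<Longrightarrow> gauge_at b \<le> norm (b + s *\<^sub>R d) - s"
  unfolding gauge_at_def by (rule cINF_lower2[OF gauge_at_bdd_below, of "(s, d)"]) auto

lemma gauge_at_approx:
  assumes "0 < e"
  obtains s d where "0 \<le> s" "d \<in> D" "norm (b + s *\<^sub>R d) - s < gauge_at b + e"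
proof -
  have "(INF (s, d) \<in> {0..} \<times> D. norm (b + s *\<^sub>R d) - s) < gauge_at b + e"
    using assms by (simp add: gauge_at_def)
  then show ?thesis
    using that nonempty by (subst (asm) cINF_less_iff[OF _ gauge_at_bdd_below]) auto
qed

lemma gauge_at_le_norm: "gauge_at b \<le> norm b"
  using gauge_at_le[of 0 _ b] nonempty by auto

lemma gauge_at_add_le: "gauge_at (b + c) \<le> gauge_at b + gauge_at c"
proof (rule field_le_epsilon)
  fix e :: real assume "0 < e"
  then have "0 < e / 2"
    by simp
  obtain s d where s: "0 \<le> s" "d \<in> D" "norm (b + s *\<^sub>R d) - s < gauge_at b + e / 2"
    by (rule gauge_at_approx[OF \<open>0 < e / 2\<close>])
  obtain t h where t: "0 \<le> t" "h \<in> D" "norm (c + t *\<^sub>R h) - t < gauge_at c + e / 2"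
    by (rule gauge_at_approx[OF \<open>0 < e / 2\<close>])
  obtain k where k: "k \<in> D" "(s + t) *\<^sub>R k = s *\<^sub>R d + t *\<^sub>R h"
  proof (cases "s + t = 0")
    case True
    then show ?thesis
      using that[OF s(2)] s(1) t(1) by (simp add: add_nonneg_eq_0_iff)
  next
    case False
    have "(s / (s + t)) *\<^sub>R d + (t / (s + t)) *\<^sub>R h \<in> D"
      using s t False by (intro convexD[OF convex_D]) (auto simp: add_divide_distrib[symmetric])
    then show ?thesis
      using False by (intro that) (auto simp: scaleR_add_right)
  qed
  have "gauge_at (b + c) \<le> norm ((b + c) + (s + t) *\<^sub>R k) - (s + t)"
    using s t k by (intro gauge_at_le) auto
  also have "(b + c) + (s + t) *\<^sub>R k = (b + s *\<^sub>R d) + (c + t *\<^sub>R h)"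
    unfolding k(2) by simp
  also have "norm \<dots> \<le> norm (b + s *\<^sub>R d) + norm (c + t *\<^sub>R h)"
    by (rule norm_triangle_ineq)
  finally show "gauge_at (b + c) \<le> gauge_at b + gauge_at c + e"
    using s(3) t(3) by linarith
qed

lemma gauge_at_scaleR_le:
  assumes "0 < r"
  shows "gauge_at (r *\<^sub>R b) \<le> r * gauge_at b"
proof (rule field_le_epsilon)
  fix e :: real assume "0 < e"
  then have "0 < e / r"
    using assms by simp
  obtain s d where s: "0 \<le> s" "d \<in> D" "norm (b + s *\<^sub>R d) - s < gauge_at b + e / r"
    by (rule gauge_at_approx[OF \<open>0 < e / r\<close>])
  have "gauge_at (r *\<^sub>R b) \<le> norm (r *\<^sub>R b + (r * s) *\<^sub>R d) - r * s"
    using s assms by (intro gauge_at_le) auto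
  also have "r *\<^sub>R b + (r * s) *\<^sub>R d = r *\<^sub>R (b + s *\<^sub>R d)"
    by (simp add: scaleR_add_right)
  also have "norm (r *\<^sub>R (b + s *\<^sub>R d)) - r * s = r * (norm (b + s *\<^sub>R d) - s)"
    using assms by (simp add: right_diff_distrib)
  also have "\<dots> \<le> r * (gauge_at b + e / r)"
    using s(3) assms by (intro mult_left_mono) auto
  finally show "gauge_at (r *\<^sub>R b) \<le> r * gauge_at b + e"
    using assms by (simp add: distrib_left)
qed

lemma gauge_at_zero: "gauge_at 0 = 0"
proof (rule antisym)
  show "gauge_at 0 \<le> 0"
    using gauge_at_le_norm[of 0] by simp
  show "0 \<le> gauge_at 0"
    unfolding gauge_at_def using nonempty norm_eq_1 by (intro cINF_greatest) auto
qed

lemma gauge_at_scaleR: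
  assumes "0 \<le> r"
  shows "gauge_at (r *\<^sub>R b) = r * gauge_at b"
proof (cases "r = 0")
  case True
  then show ?thesis
    by (simp add: gauge_at_zero)
next
  case False
  with assms have r: "0 < r"
    by simp
  have "gauge_at b \<le> inverse r * gauge_at (r *\<^sub>R b)"
    using gauge_at_scaleR_le[of "inverse r" "r *\<^sub>R b"] r by simp
  then have "r * gauge_at b \<le> gauge_at (r *\<^sub>R b)"
    using r by (simp add: field_simps)
  with gauge_at_scaleR_le[OF r, of b] show ?thesis
    by simp
qed

lemma gauge_at_minus_ge: "- gauge_at b \<le> gauge_at (- b)"
  using gauge_at_add_le[of b "- b"] gauge_at_zero by simp

lemma gauge_at_diff_ge: "gauge_at b - gauge_at c \<le> gauge_at (b - c)"
  using gauge_at_add_le[of "b - c" c] by simp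

end

lemma maximal_face_sphere_face: "maximal_face B C \<Longrightarrow> sphere_face C"
  by unfold_locales (auto dest: maximal_faceD maximal_face_norm)

text \<open>
  The modulus of \<open>\<kappa> + s\<close> exceeds \<open>s\<close> by \<open>Re \<kappa>\<close> in the limit of large \<open>s\<close>. This is how the gauge,
  an infimum over \<open>s\<close>, produces real parts.
\<close>

lemma cmod_shift_approx_Re:
  fixes \<kappa> :: complex
  assumes "0 < e"
  obtains s :: real where "0 \<le> s" "cmod (\<kappa> + s) - s \<le> Re \<kappa> + e"
proof -
  define a b where "a = Re \<kappa>" and "b = Im \<kappa>"
  define s where "s = \<bar>a\<bar> + b\<^sup>2 / (2 * e)"
  have s0: "0 \<le> s" and as: "b\<^sup>2 / (2 * e) \<le> a + s"
    using assms by (auto simp: s_def)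
  have "0 \<le> b\<^sup>2 / (2 * e)"
    using assms by simp
  then have nn: "0 \<le> a + s + e"
    using as assms by linarith
  have "b\<^sup>2 \<le> 2 * e * (a + s)"
    using as assms by (simp add: field_simps)
  then have "(a + s)\<^sup>2 + b\<^sup>2 \<le> (a + s + e)\<^sup>2"
    using zero_le_square[of e] unfolding power2_eq_square by (simp only: algebra_simps)
  then have "cmod (\<kappa> + s) \<le> a + s + e"
    using nn by (simp add: cmod_def a_def b_def real_le_lsqrt)
  then show ?thesis
    using that[OF s0] by (simp add: a_def)
qed

locale complex_sphere_face = sphere_face D for D :: "'a::complex_normed_vector set"
begin

lemma gauge_at_multiple_le:
  assumes "d \<in> D"
  shows "gauge_at (\<kappa> *\<^sub>C d) \<le> Re \<kappa>"
proof (rule field_le_epsilon)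
  fix e :: real assume "0 < e"
  then obtain s where s: "0 \<le> s" "cmod (\<kappa> + s) - s \<le> Re \<kappa> + e"
    by (rule cmod_shift_approx_Re)
  have "gauge_at (\<kappa> *\<^sub>C d) \<le> norm (\<kappa> *\<^sub>C d + s *\<^sub>R d) - s"
    using s assms by (intro gauge_at_le)
  also have "\<kappa> *\<^sub>C d + s *\<^sub>R d = (\<kappa> + s) *\<^sub>C d"
    by (simp add: scaleR_scaleC scaleC_add_left)
  finally show "gauge_at (\<kappa> *\<^sub>C d) \<le> Re \<kappa> + e"
    using s norm_eq_1[OF assms] by (simp add: norm_scaleC)
qed

lemma gauge_at_multiple:
  assumes "d \<in> D"
  shows "gauge_at (\<kappa> *\<^sub>C d) = Re \<kappa>"
proof (rule antisym[OF gauge_at_multiple_le[OF assms]])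
  have "gauge_at (- (\<kappa> *\<^sub>C d)) \<le> - Re \<kappa>"
    using gauge_at_multiple_le[OF assms, of "- \<kappa>"] by simp
  then show "Re \<kappa> \<le> gauge_at (\<kappa> *\<^sub>C d)"
    using gauge_at_minus_ge[of "\<kappa> *\<^sub>C d"] by linarith
qed

lemma multiple_dist:
  assumes "d \<in> D" "d' \<in> D"
  shows "cmod (\<kappa> - \<kappa>') \<le> norm (\<kappa> *\<^sub>C d - \<kappa>' *\<^sub>C d')"
proof (cases "\<kappa> = \<kappa>'")
  case False
  \<comment> \<open>\<open>\<mu>\<close> rotates \<open>\<kappa> - \<kappa>'\<close> to the positive reals, so that the gauge sees its full modulus.\<close>
  define \<mu> where "\<mu> = cnj (\<kappa> - \<kappa>') / cmod (\<kappa> - \<kappa>')"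
  have \<mu>: "cmod \<mu> = 1" "Re (\<mu> * \<kappa>) - Re (\<mu> * \<kappa>') = cmod (\<kappa> - \<kappa>')"
  proof -
    show "cmod \<mu> = 1"
      using False complex_mod_cnj[of "\<kappa> - \<kappa>'"] by (simp add: \<mu>_def norm_divide del: complex_cnj_diff)
    have "\<mu> * (\<kappa> - \<kappa>') = cmod (\<kappa> - \<kappa>')"
      using False complex_norm_square[of "\<kappa> - \<kappa>'"]
      by (simp add: \<mu>_def power2_eq_square mult.commute divide_eq_eq del: complex_cnj_diff)
    then have "Re (\<mu> * (\<kappa> - \<kappa>')) = cmod (\<kappa> - \<kappa>')"
      by simp
    then show "Re (\<mu> * \<kappa>) - Re (\<mu> * \<kappa>') = cmod (\<kappa> - \<kappa>')"
      by (simp only: right_diff_distrib minus_complex.sel)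
  qed
  have "cmod (\<kappa> - \<kappa>') = gauge_at ((\<mu> * \<kappa>) *\<^sub>C d) - gauge_at ((\<mu> * \<kappa>') *\<^sub>C d')"
    using \<mu>(2) by (simp only: gauge_at_multiple assms)
  also have "\<dots> \<le> gauge_at ((\<mu> * \<kappa>) *\<^sub>C d - (\<mu> * \<kappa>') *\<^sub>C d')"
    by (rule gauge_at_diff_ge)
  also have "\<dots> \<le> norm ((\<mu> * \<kappa>) *\<^sub>C d - (\<mu> * \<kappa>') *\<^sub>C d')"
    by (rule gauge_at_le_norm)
  also have "(\<mu> * \<kappa>) *\<^sub>C d - (\<mu> * \<kappa>') *\<^sub>C d' = \<mu> *\<^sub>C (\<kappa> *\<^sub>C d - \<kappa>' *\<^sub>C d')"
    by (simp add: complex_vector.scale_right_diff_distrib scaleC_scaleC)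
  finally show ?thesis
    using \<mu>(1) by (simp add: norm_scaleC)
qed simp

text \<open>
  The scalar model is that a complex number within \<open>1 - r\<close> of \<open>1\<close> and within \<open>1 + r\<close> of \<open>-1\<close>
  must be \<open>r\<close>. For sublinear functionals, \<open>\<mu> c\<close> is written as \<open>(\<mu> - s) d + (\<mu> - s) (c - d) + s c\<close> with a large
  real \<open>s\<close>. The gauges of the three terms are bounded by \<open>Re \<mu> - s\<close>, by \<open>(1 - r) \<bar>\<mu> - s\<bar>\<close>, which is
  about \<open>(1 - r) (s - Re \<mu>)\<close>, and by \<open>r s\<close>; these add up to \<open>r Re \<mu>\<close>.
\<close>

lemma gauge_at_near_multiple_le:
  assumes near: "\<And>e. 0 < e \<Longrightarrow> \<exists>d\<in>D. norm (c - d) \<le> 1 - r + e"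
    and far: "\<And>e. 0 < e \<Longrightarrow> \<exists>d\<in>D. norm (c + d) \<le> 1 + r + e"
    and r: "- 1 \<le> r" "r \<le> 1"
  shows "gauge_at (\<mu> *\<^sub>C c) \<le> r * Re \<mu>"
proof (rule field_le_epsilon)
  have c: "gauge_at c \<le> r"
  proof (rule field_le_epsilon)
    fix e :: real assume "0 < e"
    then obtain d where d: "d \<in> D" "norm (c + d) \<le> 1 + r + e"
      using far by blast
    have "gauge_at c \<le> gauge_at (c + d) + gauge_at (- d)"
      using gauge_at_add_le[of "c + d" "- d"] by simp
    also have "gauge_at (- d) \<le> - 1"
      using gauge_at_multiple_le[OF d(1), of "- 1"] by (simp add: scaleC_one)
    finally show "gauge_at c \<le> r + e"
      using gauge_at_le_norm[of "c + d"] d(2) by linarith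
  qed
  fix e :: real assume e: "0 < e"
  then have "0 < e / 4"
    by simp
  then obtain s where s: "0 \<le> s" "cmod (- \<mu> + s) - s \<le> Re (- \<mu>) + e / 4"
    by (rule cmod_shift_approx_Re)
  define e' where "e' = e / (4 * (cmod (\<mu> - s) + 1))"
  have e': "0 < e'" "cmod (\<mu> - s) * e' \<le> e / 4"
    using e by (auto simp: e'_def field_simps add_pos_nonneg intro: add_nonneg_pos)
  obtain d where d: "d \<in> D" "norm (c - d) \<le> 1 - r + e'"
    using near[OF e'(1)] by blast
  have split: "\<mu> *\<^sub>C c = (\<mu> - s) *\<^sub>C d + ((\<mu> - s) *\<^sub>C (c - d) + s *\<^sub>R c)"
    by (simp add: scaleR_scaleC complex_vector.scale_left_diff_distrib
        complex_vector.scale_right_diff_distrib)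
  have "gauge_at (\<mu> *\<^sub>C c)
      \<le> gauge_at ((\<mu> - s) *\<^sub>C d) + (gauge_at ((\<mu> - s) *\<^sub>C (c - d)) + gauge_at (s *\<^sub>R c))"
    unfolding split by (intro order_trans[OF gauge_at_add_le] add_left_mono gauge_at_add_le)
  also have "gauge_at ((\<mu> - s) *\<^sub>C d) = Re \<mu> - s"
    by (simp add: gauge_at_multiple[OF d(1)])
  also have "gauge_at (s *\<^sub>R c) \<le> s * r"
    using s(1) c by (simp add: gauge_at_scaleR mult_left_mono)
  also have "gauge_at ((\<mu> - s) *\<^sub>C (c - d)) \<le> cmod (\<mu> - s) * (1 - r) + e / 4"
  proof -
    have "gauge_at ((\<mu> - s) *\<^sub>C (c - d)) \<le> cmod (\<mu> - s) * norm (c - d)"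
      using gauge_at_le_norm[of "(\<mu> - s) *\<^sub>C (c - d)"] by (simp add: norm_scaleC)
    also have "\<dots> \<le> cmod (\<mu> - s) * (1 - r + e')"
      using d(2) by (intro mult_left_mono) auto
    finally show ?thesis
      using e'(2) by (simp add: distrib_left)
  qed
  finally have "gauge_at (\<mu> *\<^sub>C c) \<le> Re \<mu> - s + (cmod (\<mu> - s) * (1 - r) + e / 4 + s * r)"
    by simp
  moreover have "cmod (\<mu> - s) * (1 - r) \<le> (s - Re \<mu> + e / 4) * (1 - r)"
    using s(2) r norm_minus_commute[of \<mu> s] by (intro mult_right_mono) auto
  moreover have "e * (- 1) \<le> e * r"
    using e r by (intro mult_left_mono) auto
  moreover have "(s - Re \<mu> + e / 4) * (1 - r) = s - Re \<mu> + e / 4 - s * r + r * Re \<mu> - e * r / 4"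
    by (simp add: field_simps)
  ultimately show "gauge_at (\<mu> *\<^sub>C c) \<le> r * Re \<mu> + e"
    using e by linarith
qed

lemma gauge_at_near_multiple:
  assumes near: "\<And>e. 0 < e \<Longrightarrow> \<exists>d\<in>D. norm (c - d) \<le> 1 - r + e"
    and far: "\<And>e. 0 < e \<Longrightarrow> \<exists>d\<in>D. norm (c + d) \<le> 1 + r + e"
    and r: "- 1 \<le> r" "r \<le> 1"
  shows "gauge_at (\<mu> *\<^sub>C c) = r * Re \<mu>"
proof (rule antisym[OF gauge_at_near_multiple_le[OF assms]])
  have "gauge_at (- (\<mu> *\<^sub>C c)) \<le> - (r * Re \<mu>)"
    using gauge_at_near_multiple_le[OF assms, of "- \<mu>"] by simp
  then show "r * Re \<mu> \<le> gauge_at (\<mu> *\<^sub>C c)"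
    using gauge_at_minus_ge[of "\<mu> *\<^sub>C c"] by linarith
qed

end

section \<open>Faces of a function algebra\<close>

lemma unimodular_eqI:
  fixes a w :: complex
  assumes "cmod a \<le> 1" "cmod w = 1" "1 \<le> Re (cnj w * a)"
  shows "a = w"
proof -
  have "(cmod (a - w))\<^sup>2 = (cmod a)\<^sup>2 + (cmod w)\<^sup>2 - 2 * Re (cnj w * a)"
    unfolding cmod_power2 by (simp add: power2_eq_square algebra_simps)
  also have "\<dots> \<le> 1 + 1 - 2 * 1"
    using assms power_le_one[of "cmod a" 2] by (intro diff_mono add_mono) auto
  finally show ?thesis
    by simp
qed

text \<open>
  Unimodular numbers are extreme points of the unit disc.
\<close>

lemma average_unimodular:
  fixes a :: "'i \<Rightarrow> complex"
  assumes J: "finite J" and a: "\<And>j. j \<in> J \<Longrightarrow> cmod (a j) \<le> 1" and w: "cmod w = 1"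
    and sum: "(\<Sum>j\<in>J. a j) = of_nat (card J) * w" and i: "i \<in> J"
  shows "a i = w"
proof (rule unimodular_eqI[OF a[OF i] w])
  have le: "Re (cnj w * a j) \<le> 1" if "j \<in> J" for j
    using complex_Re_le_cmod[of "cnj w * a j"] a[OF that] w by (simp add: norm_mult)
  have "cnj w * w = 1"
    using complex_norm_square[of w] w by (simp add: mult.commute)
  then have "(\<Sum>j\<in>J. cnj w * a j) = of_nat (card J)"
    unfolding sum_distrib_left[symmetric] sum by (simp add: mult.left_commute)
  then have "(\<Sum>j\<in>J. Re (cnj w * a j)) = (\<Sum>j\<in>J. 1)"
    unfolding Re_sum[symmetric] by simp
  then have "(\<Sum>j\<in>J. 1 - Re (cnj w * a j)) = 0"
    by (simp only: sum_subtractf)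
  then have "1 - Re (cnj w * a i) = 0"
    using sum_nonneg_eq_0_iff[OF J, of "\<lambda>j. 1 - Re (cnj w * a j)"] le i by auto
  then show "1 \<le> Re (cnj w * a i)"
    by simp
qed

text \<open>
  The case of a small term \<open>a m\<close> gains \<open>(1/2)^m / 4\<close> over the trivial bound. In the norm
  correction below, this gain is set against an excess of the order of \<open>(1/2)^m\<close>.
\<close>

lemma half_series_bound:
  fixes a :: "nat \<Rightarrow> complex"
  assumes a: "\<And>n. cmod (a n) \<le> 1"
  shows "summable (\<lambda>n. (1/2) ^ Suc n * a n)" "cmod (\<Sum>n. (1/2) ^ Suc n * a n) \<le> 1"
    "cmod (a m) \<le> 1/2 \<Longrightarrow> cmod (\<Sum>n. (1/2) ^ Suc n * a n) \<le> 1 - (1/2) ^ m / 4"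
proof -
  let ?t = "\<lambda>n. (1/2) ^ Suc n * a n"
  have half: "(\<lambda>n. (1/2 :: real) ^ Suc n) sums 1"
    by (rule power_half_series)
  have nt: "cmod (?t n) = (1/2) ^ Suc n * cmod (a n)" for n
    by (simp add: norm_mult norm_power norm_divide)
  have le: "cmod (?t n) \<le> (1/2) ^ Suc n" for n
    unfolding nt using a[of n] by (intro mult_right_le_one_le) auto
  have bound: "summable (\<lambda>n. cmod (?t n))"
  proof (rule summable_comparison_test'[OF sums_summable[OF half]])
    show "norm (cmod (?t n)) \<le> (1/2) ^ Suc n" for n
      unfolding real_norm_def abs_norm_cancel by (rule le)
  qed
  then show "summable ?t"
    by (rule summable_norm_cancel)
  have upper: "cmod (\<Sum>n. ?t n) \<le> s" if "b sums s" "\<And>n. cmod (?t n) \<le> b n" for b s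
    using summable_norm[OF bound] suminf_le[OF that(2) bound sums_summable[OF that(1)]]
      sums_unique[OF that(1)] by linarith
  show "cmod (\<Sum>n. ?t n) \<le> 1"
    using half le by (rule upper)
  assume m: "cmod (a m) \<le> 1/2"
  define b :: "nat \<Rightarrow> real" where "b n = (1/2) ^ Suc n - (if n = m then (1/2) ^ m / 4 else 0)" for n
  have "b sums (1 - (1/2) ^ m / 4)"
    unfolding b_def by (intro sums_diff half sums_single)
  moreover have "cmod (?t n) \<le> b n" for n
  proof (cases "n = m")
    case True
    have "(1/2) ^ Suc m * cmod (a m) \<le> (1/2) ^ Suc m * (1/2)"
      using m by (intro mult_left_mono) auto
    then show ?thesis
      unfolding nt b_def using True by simp
  next
    case False
    then show ?thesis
      using le[of n] by (simp add: b_def)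
  qed
  ultimately show "cmod (\<Sum>n. ?t n) \<le> 1 - (1/2) ^ m / 4"
    by (rule upper)
qed

lemma damping_estimate:
  fixes e u :: real
  assumes "0 < e" "e \<le> 1/8" "0 \<le> u" "u \<le> 1" "t \<le> 1 + 2 * e\<^sup>2 * u" "0 \<le> t"
    and "s \<le> 1 - e * (u / 4)"
  shows "t * s \<le> 1"
proof -
  have "e * (u / 4) \<le> 1 * 1"
    using assms by (intro mult_mono) auto
  have "t * s \<le> t * (1 - e * (u / 4))"
    using assms by (intro mult_left_mono)
  also have "\<dots> \<le> (1 + 2 * e\<^sup>2 * u) * (1 - e * (u / 4))"
    using assms \<open>e * (u / 4) \<le> 1 * 1\<close> by (intro mult_right_mono) auto
  also have "\<dots> = 1 - 2 * (e * u) * (1/8 - e) - 2 * e\<^sup>2 * u * (e * (u / 4))"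
    by (simp add: algebra_simps power2_eq_square)
  also have "\<dots> \<le> 1"
  proof -
    have "0 \<le> 2 * (e * u) * (1/8 - e)" "0 \<le> 2 * e\<^sup>2 * u * (e * (u / 4))"
      using assms by (intro mult_nonneg_nonneg; simp)+
    then show ?thesis
      by linarith
  qed
  finally show ?thesis .
qed

lemma apply_bcontfun_sum:
  fixes f :: "'i \<Rightarrow> 'a::topological_space \<Rightarrow>\<^sub>C 'b::real_normed_vector"
  shows "apply_bcontfun (\<Sum>i\<in>I. f i) x = (\<Sum>i\<in>I. apply_bcontfun (f i) x)"
  by (induction I rule: infinite_finite_induct) auto

lemma complete_closed_bcontfun:
  fixes S :: "('a::topological_space \<Rightarrow>\<^sub>C 'b::complete_space) set"
  assumes "closed S"
  shows "complete S"
  unfolding complete_def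
proof (intro allI impI, elim conjE)
  fix f assume f: "\<forall>n. f n \<in> S" "Cauchy f"
  then obtain g where "uniform_limit UNIV f g sequentially"
    using uniformly_convergent_eq_cauchy[of "\<lambda>_. True" f]
    unfolding Cauchy_def uniform_limit_sequentially_iff
    by (metis dist_fun_lt_imp_dist_val_lt)
  then obtain l where l: "f \<longlonglongrightarrow> l"
    using sequentially_bot by (rule uniform_limit_bcontfunE)
  then have "l \<in> S"
    using assms f(1) by (metis closed_sequentially)
  with l show "\<exists>l\<in>S. f \<longlonglongrightarrow> l"
    by blast
qed

lemmas apply_simps = scaleC_bcontfun.rep_eq times_bcontfun.rep_eq scaleC_complex_def

locale c0_algebra =
  fixes A :: "('y::t2_space \<Rightarrow>\<^sub>C complex) set"
  assumes C0: "A \<subseteq> C0" and subalgebra: "complex_subalgebra A" and closed_A: "closed A"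
begin

lemma complex_subspace: "complex_vector.subspace A"
  using subalgebra by (simp add: complex_subalgebra_def)

lemma scaleC_mem: "f \<in> A \<Longrightarrow> c *\<^sub>C f \<in> A"
  using complex_subspace by (rule complex_vector.subspace_scale)

lemma add_mem: "f \<in> A \<Longrightarrow> g \<in> A \<Longrightarrow> f + g \<in> A"
  using complex_subspace by (rule complex_vector.subspace_add)

lemma zero_mem: "0 \<in> A"
  using complex_subspace by (rule complex_vector.subspace_0)

lemma mult_mem: "f \<in> A \<Longrightarrow> g \<in> A \<Longrightarrow> f * g \<in> A"
  using subalgebra by (simp add: complex_subalgebra_def)

lemma scaleR_mem: "f \<in> A \<Longrightarrow> r *\<^sub>R f \<in> A"
  by (simp add: scaleR_scaleC scaleC_mem)

lemma subspace: "subspace A"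
  by (intro subspaceI zero_mem add_mem scaleR_mem)

lemma sum_mem: "(\<And>i. i \<in> I \<Longrightarrow> f i \<in> A) \<Longrightarrow> (\<Sum>i\<in>I. f i) \<in> A"
  using subspace by (rule subspace_sum)

lemma power_mem:
  assumes "f \<in> A"
  shows "\<exists>g\<in>A. \<forall>y. apply_bcontfun g y = apply_bcontfun f y ^ Suc n"
proof (induction n)
  case 0
  then show ?case
    using assms by auto
next
  case (Suc n)
  then obtain g where "g \<in> A" "\<forall>y. apply_bcontfun g y = apply_bcontfun f y ^ Suc n"
    by blast
  then show ?case
    using assms by (intro bexI[of _ "f * g"]) (auto simp: apply_simps mult_mem)
qed

lemma compact_level:
  assumes "f \<in> A" "0 < e"
  shows "compact {y. e \<le> cmod (apply_bcontfun f y)}"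
proof -
  have "f \<in> C0"
    using C0 assms(1) by (rule subsetD)
  then show ?thesis
    using assms(2) by (simp add: C0_def)
qed

lemma norm_attained:
  assumes f: "f \<in> A" "f \<noteq> 0"
  obtains x where "cmod (apply_bcontfun f x) = norm f"
proof -
  obtain y where y: "apply_bcontfun f y \<noteq> 0"
    using f(2) by (metis bcontfun_eqI zero_bcontfun.rep_eq)
  define K where "K = {z. cmod (apply_bcontfun f y) \<le> cmod (apply_bcontfun f z)}"
  have "compact K"
    unfolding K_def using f(1) y by (intro compact_level) auto
  moreover have "K \<noteq> {}"
    by (auto simp: K_def)
  moreover have "continuous_on K (\<lambda>z. cmod (apply_bcontfun f z))"
    by (intro continuous_intros continuous_on_apply_bcontfun)
  ultimately obtain x where x: "x \<in> K" "\<forall>z\<in>K. cmod (apply_bcontfun f z) \<le> cmod (apply_bcontfun f x)"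
    by (metis continuous_attains_sup)
  have "cmod (apply_bcontfun f z) \<le> cmod (apply_bcontfun f x)" for z
    using x by (cases "z \<in> K") (auto simp: K_def)
  then have "norm f \<le> cmod (apply_bcontfun f x)"
    by (rule norm_bound)
  then show ?thesis
    using that[of x] norm_bounded[of f x] by simp
qed

definition face :: "'y \<Rightarrow> complex \<Rightarrow> ('y \<Rightarrow>\<^sub>C complex) set" where
  "face x l = {f \<in> unit_sphere A. apply_bcontfun f x = l}"

lemma faceI:
  assumes "f \<in> A" "\<And>y. cmod (apply_bcontfun f y) \<le> 1" "apply_bcontfun f x = l" "cmod l = 1"
  shows "f \<in> face x l"
proof -
  have "norm f = 1"
    using norm_bound[of f 1] norm_bounded[of f x] assms by auto
  then show ?thesis
    using assms by (simp add: face_def unit_sphere_def)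
qed

lemma faceD:
  assumes "f \<in> face x l"
  shows "f \<in> A" "cmod (apply_bcontfun f y) \<le> 1" "apply_bcontfun f x = l" "norm f = 1"
  using assms norm_bounded[of f y] by (auto simp: face_def unit_sphere_def)

lemma face_subset: "face x l \<subseteq> unit_sphere A"
  by (auto simp: face_def)

lemma face_scaleC_iff:
  assumes "cmod c = 1"
  shows "c *\<^sub>C f \<in> face x (c * l) \<longleftrightarrow> f \<in> face x l"
proof -
  have c0: "c \<noteq> 0"
    using assms by auto
  then have c: "c \<noteq> 0" "inverse c *\<^sub>C c *\<^sub>C f = f"
    by (simp_all add: scaleC_scaleC scaleC_one)
  have "c *\<^sub>C f \<in> A \<longleftrightarrow> f \<in> A"
    using scaleC_mem[of f c] scaleC_mem[of "c *\<^sub>C f" "inverse c"] c(2) by auto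
  then show ?thesis
    using assms c(1) by (simp add: face_def unit_sphere_def norm_scaleC apply_simps)
qed

lemma scaleC_image_face:
  assumes "cmod c = 1"
  shows "scaleC c ` face x l = face x (c * l)"
proof
  show "scaleC c ` face x l \<subseteq> face x (c * l)"
    using face_scaleC_iff[OF assms] by blast
  have c0: "c \<noteq> 0"
    using assms by auto
  show "face x (c * l) \<subseteq> scaleC c ` face x l"
  proof
    fix f assume f: "f \<in> face x (c * l)"
    have eq: "f = c *\<^sub>C (inverse c *\<^sub>C f)"
      using c0 by (simp add: scaleC_scaleC scaleC_one)
    with f have "inverse c *\<^sub>C f \<in> face x l"
      using face_scaleC_iff[OF assms, of "inverse c *\<^sub>C f" x l] by simp
    with eq show "f \<in> scaleC c ` face x l"
      by (rule image_eqI)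
  qed
qed

lemma convex_face:
  assumes "cmod l = 1"
  shows "convex (face x l)"
proof (rule convexI)
  fix f g and u v :: real
  assume f: "f \<in> face x l" and g: "g \<in> face x l" and uv: "0 \<le> u" "0 \<le> v" "u + v = 1"
  have "cmod (apply_bcontfun (u *\<^sub>R f + v *\<^sub>R g) y) \<le> 1" for y
  proof -
    have "cmod (u *\<^sub>R apply_bcontfun f y + v *\<^sub>R apply_bcontfun g y)
        \<le> cmod (u *\<^sub>R apply_bcontfun f y) + cmod (v *\<^sub>R apply_bcontfun g y)"
      by (rule norm_triangle_ineq)
    also have "\<dots> \<le> u * 1 + v * 1"
      unfolding norm_scaleR using faceD(2)[OF f] faceD(2)[OF g] uv
      by (intro add_mono mult_mono) auto
    finally show ?thesis
      using uv by simp
  qed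
  then show "u *\<^sub>R f + v *\<^sub>R g \<in> face x l"
    using assms faceD[OF f] faceD[OF g] uv
    by (intro faceI add_mem scaleR_mem) (auto simp flip: scaleR_left.add)
qed

text \<open>
  The average of \<open>J\<close> has norm 1 and attains it at some \<open>x\<close>; there its value is an extreme point
  of the disc, so the members of \<open>J\<close> agree.
\<close>

lemma finite_common_value:
  assumes C: "C \<subseteq> unit_sphere A" "convex C" and J: "finite J" "J \<subseteq> C" "J \<noteq> {}"
  obtains x w where "cmod w = 1" "\<And>f. f \<in> J \<Longrightarrow> apply_bcontfun f x = w"
proof -
  define h where "h = (\<Sum>f\<in>J. (1 / card J) *\<^sub>R f)"
  have "h \<in> C"
    unfolding h_def using J C(2) by (intro convex_sum) auto
  then have h: "h \<in> A" "norm h = 1"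
    using C by (auto simp: unit_sphere_def)
  then have "h \<noteq> 0"
    by auto
  then obtain x where x: "cmod (apply_bcontfun h x) = 1"
    using norm_attained[OF h(1)] h(2) by metis
  have "(\<Sum>f\<in>J. apply_bcontfun f x) = of_nat (card J) * apply_bcontfun h x"
    using J by (simp add: h_def apply_bcontfun_sum scaleR_conv_of_real sum_distrib_left)
  moreover have "cmod (apply_bcontfun f x) \<le> 1" if "f \<in> J" for f
    using that J C norm_bounded[of f x] by (auto simp: unit_sphere_def)
  ultimately have "apply_bcontfun f x = apply_bcontfun h x" if "f \<in> J" for f
    using J(1) x that by (intro average_unimodular[of J "\<lambda>f. apply_bcontfun f x"])
  then show ?thesis
    using that x by blast
qed

text \<open>
  The previous lemma provides the finite intersection property. Since the common value varies with the finite
  subset, it is expressed by agreement with one fixed member \<open>g\<close>, which also confines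
  the points to a compact set.
\<close>

theorem maximal_face_eq_face:
  assumes C: "maximal_face A C"
  obtains x l where "cmod l = 1" "C = face x l"
proof -
  note Cf = maximal_faceD[OF C]
  obtain g where g: "g \<in> C"
    using Cf(1) by blast
  then have gA: "g \<in> A"
    using Cf(2) by (auto simp: unit_sphere_def)
  define L where "L f = {y. cmod (apply_bcontfun g y) = 1} \<inter> {y. apply_bcontfun f y = apply_bcontfun g y}"
    for f
  have "{y. 1 \<le> cmod (apply_bcontfun g y)} \<inter> (\<Inter>f\<in>C. L f) \<noteq> {}"
  proof (rule compact_imp_fip_image)
    show "compact {y. 1 \<le> cmod (apply_bcontfun g y)}"
      using gA by (intro compact_level) auto
    show "closed (L f)" for f
      unfolding L_def by (intro closed_Int closed_Collect_eq continuous_intros continuous_on_apply_bcontfun)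
    fix I assume I: "finite I" "I \<subseteq> C"
    have I': "finite (insert g I)" "insert g I \<subseteq> C" "insert g I \<noteq> {}"
      using I g by auto
    obtain x w where w: "cmod w = 1" "\<And>f. f \<in> insert g I \<Longrightarrow> apply_bcontfun f x = w"
      by (rule finite_common_value[OF Cf(2,3) I']) (rule that)
    then have "x \<in> {y. 1 \<le> cmod (apply_bcontfun g y)} \<inter> (\<Inter>f\<in>I. L f)"
      by (auto simp: L_def)
    then show "{y. 1 \<le> cmod (apply_bcontfun g y)} \<inter> (\<Inter>f\<in>I. L f) \<noteq> {}"
      by blast
  qed
  then obtain x where x: "\<And>f. f \<in> C \<Longrightarrow> x \<in> L f"
    by blast
  define l where "l = apply_bcontfun g x"
  have l: "cmod l = 1"
    using x[OF g] by (simp add: L_def l_def)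
  have "C \<subseteq> face x l"
    using x Cf(2) by (auto simp: L_def l_def face_def)
  then have "face x l = C"
    using Cf(4) face_subset convex_face[OF l] by blast
  then show ?thesis
    using that l by blast
qed

section \<open>Peaking functions and norm correction\<close>

definition boundary_point :: "'y \<Rightarrow> bool" where
  "boundary_point x \<longleftrightarrow> maximal_face A (face x 1)"

lemma maximal_face_iff_boundary_point:
  assumes l: "cmod l = 1"
  shows "maximal_face A (face x l) \<longleftrightarrow> boundary_point x"
proof -
  have "l * cnj l = 1" "cnj l * l = 1" "cmod (cnj l) = 1"
    using complex_norm_square[of l] l by (simp_all add: mult.commute)
  then show ?thesis
    using maximal_face_scaleC[OF complex_subspace l, of "face x 1"]
      maximal_face_scaleC[OF complex_subspace, of "cnj l" "face x l"]
      scaleC_image_face[OF l, of x 1] scaleC_image_face[of "cnj l" x l]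
    by (auto simp: boundary_point_def)
qed

definition peak_set :: "'y \<Rightarrow> 'y set" where
  "peak_set x = {y. \<forall>g\<in>face x 1. apply_bcontfun g y = 1}"

lemma peak_setD: "y \<in> peak_set x \<Longrightarrow> g \<in> face x 1 \<Longrightarrow> apply_bcontfun g y = 1"
  by (simp add: peak_set_def)

lemma self_in_peak_set: "x \<in> peak_set x"
  by (simp add: peak_set_def face_def)

lemma boundary_point_obtains:
  assumes "boundary_point x"
  obtains g where "g \<in> face x 1"
  using maximal_faceD(1)[of A "face x 1"] assms unfolding boundary_point_def by blast

text \<open>
  Peak sets of boundary points are minimal: any of their points determines the same face.
\<close>

lemma peak_set_face:
  assumes x: "boundary_point x" and y: "y \<in> peak_set x"
  shows "face y 1 = face x 1"
proof -
  have "face x 1 \<subseteq> face y 1"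
    using peak_setD[OF y] by (auto simp: face_def)
  then show ?thesis
    using maximal_faceD(4)[OF x[unfolded boundary_point_def]] face_subset convex_face[of 1 y] by simp
qed

text \<open>
  Finitely many members of the face detect all of \<open>K\<close>, and their average \<open>h\<close> differs from 1 on
  \<open>K\<close>. The passage to \<open>(h + h^2) / 2\<close> turns this into modulus less than 1, and powers make it small.
\<close>

lemma peaking_function:
  assumes x: "boundary_point x" and K: "compact K" "K \<inter> peak_set x = {}" and s: "0 < s"
  obtains k where "k \<in> face x 1" "\<And>y. y \<in> K \<Longrightarrow> cmod (apply_bcontfun k y) \<le> s"
proof -
  obtain g0 where g0: "g0 \<in> face x 1"
    by (rule boundary_point_obtains[OF x])
  have "K \<subseteq> (\<Union>g\<in>face x 1. {y. apply_bcontfun g y \<noteq> 1})"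
    using K(2) by (auto simp: peak_set_def)
  moreover have "open {y. apply_bcontfun g y \<noteq> 1}" for g :: "'y \<Rightarrow>\<^sub>C complex"
    by (intro open_Collect_neq continuous_intros continuous_on_apply_bcontfun)
  ultimately obtain F where F: "F \<subseteq> face x 1" "finite F" "K \<subseteq> (\<Union>g\<in>F. {y. apply_bcontfun g y \<noteq> 1})"
    using compactE_image[OF K(1), of "face x 1" "\<lambda>g. {y. apply_bcontfun g y \<noteq> 1}"] by metis
  define J where "J = insert g0 F"
  have J: "finite J" "J \<subseteq> face x 1" "J \<noteq> {}"
    using F g0 by (auto simp: J_def)
  define h where "h = (\<Sum>f\<in>J. (1 / card J) *\<^sub>R f)"
  have h: "h \<in> face x 1"
    unfolding h_def using J convex_face[of 1 x] by (intro convex_sum) auto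
  have h1: "apply_bcontfun h y \<noteq> 1" if y: "y \<in> K" for y
  proof
    assume "apply_bcontfun h y = 1"
    then have "(\<Sum>f\<in>J. apply_bcontfun f y) = of_nat (card J) * 1"
      using J by (simp add: h_def apply_bcontfun_sum scaleR_conv_of_real flip: sum_distrib_left sum_divide_distrib)
    moreover have "cmod (apply_bcontfun f y) \<le> 1" if "f \<in> J" for f
      using that J faceD(2) by blast
    ultimately have "apply_bcontfun f y = 1" if "f \<in> J" for f
      using J(1) that by (intro average_unimodular[of J "\<lambda>f. apply_bcontfun f y" 1]) auto
    then show False
      using F(3) y by (auto simp: J_def)
  qed
  define k where "k = (1 / 2 :: real) *\<^sub>R (h + h * h)"
  have ky: "apply_bcontfun k y = apply_bcontfun h y * ((1 + apply_bcontfun h y) / 2)" for y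
    by (simp add: k_def apply_simps scaleR_conv_of_real algebra_simps)
  have half: "cmod ((1 + z) / 2) \<le> 1" if "cmod z \<le> 1" for z
    using norm_triangle_ineq[of 1 z] that by (simp add: norm_divide)
  have k1: "cmod (apply_bcontfun k y) \<le> 1" for y
    unfolding ky norm_mult using faceD(2)[OF h] by (intro mult_le_one half) auto
  have kA: "k \<in> A"
    unfolding k_def using faceD(1)[OF h] by (intro scaleR_mem add_mem mult_mem)
  have less: "cmod (apply_bcontfun k y) < 1" if y: "y \<in> K" for y
  proof (rule ccontr)
    assume "\<not> cmod (apply_bcontfun k y) < 1"
    then have "1 \<le> cmod (apply_bcontfun h y) * cmod ((1 + apply_bcontfun h y) / 2)"
      by (simp add: ky norm_mult)
    also have "\<dots> \<le> 1 * cmod ((1 + apply_bcontfun h y) / 2)"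
      using faceD(2)[OF h] by (intro mult_right_mono) auto
    finally have "2 \<le> cmod (1 + apply_bcontfun h y)"
      by (simp add: norm_divide)
    then have "2\<^sup>2 \<le> (cmod (1 + apply_bcontfun h y))\<^sup>2"
      by (intro power_mono) auto
    moreover have "(cmod (apply_bcontfun h y))\<^sup>2 \<le> 1"
      using faceD(2)[OF h] by (intro power_le_one) auto
    ultimately have "1 \<le> Re (apply_bcontfun h y)"
      unfolding cmod_power2 by (simp add: power2_eq_square algebra_simps)
    then have "apply_bcontfun h y = 1"
      using faceD(2)[OF h] by (intro unimodular_eqI) auto
    then show False
      using h1[OF y] by simp
  qed
  obtain m where m: "0 \<le> m" "m < 1" "\<And>y. y \<in> K \<Longrightarrow> cmod (apply_bcontfun k y) \<le> m"
  proof (cases "K = {}")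
    case True
    then show ?thesis
      using that[of 0] by simp
  next
    case False
    have "continuous_on K (\<lambda>z. cmod (apply_bcontfun k z))"
      by (intro continuous_intros continuous_on_apply_bcontfun)
    then obtain z where "z \<in> K" "\<forall>y\<in>K. cmod (apply_bcontfun k y) \<le> cmod (apply_bcontfun k z)"
      using continuous_attains_sup[OF K(1) False] by blast
    then show ?thesis
      using that[of "cmod (apply_bcontfun k z)"] less by simp
  qed
  obtain n where n: "m ^ n < s"
    using real_arch_pow_inv[OF s m(2)] by blast
  obtain p where p: "p \<in> A" "\<And>y. apply_bcontfun p y = apply_bcontfun k y ^ Suc n"
    using power_mem[OF kA, of n] by blast
  show ?thesis
  proof (rule that)
    show "p \<in> face x 1"
    proof (rule faceI[OF p(1)])
      show "cmod (apply_bcontfun p y) \<le> 1" for y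
        unfolding p(2) norm_power using k1 by (intro power_le_one) auto
      show "apply_bcontfun p x = 1"
        using faceD(3)[OF h] by (simp add: p(2) ky)
    qed simp
    fix y assume y: "y \<in> K"
    have "cmod (apply_bcontfun p y) \<le> m ^ Suc n"
      unfolding p(2) norm_power using m(3)[OF y] by (intro power_mono) auto
    also have "\<dots> \<le> m ^ n"
      using m by (simp add: mult_left_le_one_le)
    finally show "cmod (apply_bcontfun p y) \<le> s"
      using n by simp
  qed
qed

text \<open>
  The product of \<open>h\<close> with a mean of 1 (weight \<open>1 - e\<close>) and a series of peaking functions (weight \<open>e\<close>)
  leaves \<open>h\<close> unchanged on the peak set and moves it by a multiple of \<open>e\<close> elsewhere. The terms of the
  series are small on the sets where \<open>\<bar>h\<bar>\<close> exceeds 1 by at least \<open>e^2 (1/2)^n\<close>. At a point with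
  an excess of about \<open>e^2 u\<close>, where \<open>u = (1/2)^n\<close>, the factor is therefore at most \<open>1 - e u / 4\<close>, and as
  \<open>e \<le> 1/8\<close>, this makes up for the excess.
\<close>

lemma norm_correction:
  assumes x: "boundary_point x" and h: "h \<in> A" and e: "0 < e" "e \<le> 1/8"
    and h1: "\<And>y. cmod (apply_bcontfun h y) \<le> 1 + e\<^sup>2"
    and hE: "\<And>y. y \<in> peak_set x \<Longrightarrow> cmod (apply_bcontfun h y) \<le> 1"
  obtains G where "G \<in> A" "\<And>y. cmod (apply_bcontfun G y) \<le> 1"
    "\<And>y. y \<in> peak_set x \<Longrightarrow> apply_bcontfun G y = apply_bcontfun h y" "norm (G - h) \<le> 3 * e"
proof -
  define K where "K n = {y. 1 + e\<^sup>2 * (1/2) ^ n \<le> cmod (apply_bcontfun h y)}" for n :: nat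
  have e2: "0 < e\<^sup>2" "e\<^sup>2 \<le> 1"
    using e by (auto intro: power_le_one)
  have pos: "0 < e\<^sup>2 * (1/2) ^ n" for n :: nat
    using e2 by simp
  have "\<exists>k. k \<in> face x 1 \<and> (\<forall>y\<in>K n. cmod (apply_bcontfun k y) \<le> 1/2)" for n
  proof -
    have "compact (K n)"
      unfolding K_def using pos[of n] by (intro compact_level h) simp
    moreover have "K n \<inter> peak_set x = {}"
      using hE pos[of n] by (force simp: K_def)
    ultimately show ?thesis
      using peaking_function[OF x, of "K n" "1/2"] by (metis half_gt_zero zero_less_one)
  qed
  then obtain k where k: "\<And>n. k n \<in> face x 1"
    and kK: "\<And>n y. y \<in> K n \<Longrightarrow> cmod (apply_bcontfun (k n) y) \<le> 1/2"
    by metis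
  define \<kappa> where "\<kappa> y = (\<Sum>n. (1/2) ^ Suc n * apply_bcontfun (k n) y)" for y
  note series = half_series_bound[OF faceD(2)[OF k]]
  define F where "F n = (\<Sum>i<n. (1/2 :: real) ^ Suc i *\<^sub>R (h * k i))" for n
  have "uniform_limit UNIV (\<lambda>n y. \<Sum>i<n. apply_bcontfun ((1/2 :: real) ^ Suc i *\<^sub>R (h * k i)) y)
      (\<lambda>y. \<Sum>i. apply_bcontfun ((1/2 :: real) ^ Suc i *\<^sub>R (h * k i)) y) sequentially"
  proof (rule Weierstrass_m_test)
    show "summable (\<lambda>n. (1/2 :: real) ^ Suc n * 2)"
      using sums_summable[OF power_half_series] by (rule summable_mult2)
    fix n y
    have "cmod (apply_bcontfun h y) \<le> 2"
      using h1[of y] e2 by linarith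
    then have "cmod (apply_bcontfun h y) * cmod (apply_bcontfun (k n) y) \<le> 2 * 1"
      using faceD(2)[OF k] by (intro mult_mono) auto
    then show "norm (apply_bcontfun ((1/2 :: real) ^ Suc n *\<^sub>R (h * k n)) y) \<le> (1/2) ^ Suc n * 2"
      by (simp add: apply_simps norm_mult)
  qed
  moreover have "(\<Sum>i. apply_bcontfun ((1/2 :: real) ^ Suc i *\<^sub>R (h * k i)) y) = apply_bcontfun h y * \<kappa> y"
    for y
  proof -
    have "apply_bcontfun ((1/2 :: real) ^ Suc i *\<^sub>R (h * k i)) y
        = apply_bcontfun h y * ((1/2) ^ Suc i * apply_bcontfun (k i) y)" for i
      by (simp add: apply_simps scaleR_conv_of_real)
    then show ?thesis
      unfolding \<kappa>_def by (simp only: suminf_mult[OF series(1)])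
  qed
  ultimately have "uniform_limit UNIV (\<lambda>n. apply_bcontfun (F n))
      (\<lambda>y. apply_bcontfun h y * \<kappa> y) sequentially"
    by (simp add: F_def apply_bcontfun_sum[abs_def])
  then obtain W where W: "(\<lambda>y. apply_bcontfun h y * \<kappa> y) = apply_bcontfun W" "F \<longlonglongrightarrow> W"
    using sequentially_bot by (rule uniform_limit_bcontfunE)
  have "F n \<in> A" for n
    unfolding F_def by (intro sum_mem scaleR_mem mult_mem h faceD(1)[OF k])
  then have WA: "W \<in> A"
    using closed_A W(2) by (metis closed_sequentially)
  define G where "G = (1 - e) *\<^sub>R h + e *\<^sub>R W"
  have Gy: "apply_bcontfun G y = apply_bcontfun h y * (of_real (1 - e) + of_real e * \<kappa> y)" for y
    by (simp add: G_def W(1)[symmetric] scaleR_conv_of_real algebra_simps)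
  have \<kappa>1: "cmod (\<kappa> y) \<le> 1" for y
    unfolding \<kappa>_def by (rule series(2))
  have factor: "cmod (of_real (1 - e) + of_real e * \<kappa> y) \<le> 1 - e * s" if "cmod (\<kappa> y) \<le> 1 - s" for s y
  proof -
    have "cmod (of_real (1 - e) + of_real e * \<kappa> y)
        \<le> cmod (complex_of_real (1 - e)) + cmod (of_real e * \<kappa> y)"
      by (rule norm_triangle_ineq)
    also have "cmod (complex_of_real (1 - e)) = 1 - e"
      unfolding norm_of_real using e by simp
    also have "cmod (of_real e * \<kappa> y) \<le> e * (1 - s)"
      using that e by (simp add: norm_mult)
    finally show ?thesis
      by (simp add: algebra_simps)
  qed
  show ?thesis
  proof (rule that)
    show "G \<in> A"
      unfolding G_def by (intro add_mem scaleR_mem h WA)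
    show "cmod (apply_bcontfun G y) \<le> 1" for y
    proof (cases "cmod (apply_bcontfun h y) \<le> 1")
      case True
      then show ?thesis
        unfolding Gy norm_mult using factor[of y 0] \<kappa>1[of y] by (intro mult_le_one) auto
    next
      case False
      then have "0 < cmod (apply_bcontfun h y) - 1"
        by simp
      then have "\<exists>m. (1/2) ^ m < cmod (apply_bcontfun h y) - 1"
        by (intro real_arch_pow_inv) auto
      then obtain m where "(1/2) ^ m < cmod (apply_bcontfun h y) - 1"
        by blast
      moreover have "e\<^sup>2 * (1/2) ^ m \<le> (1/2) ^ m"
        using e2 by (simp add: mult_left_le_one_le)
      ultimately have "y \<in> K m"
        unfolding K_def mem_Collect_eq by linarith
      then have ex: "\<exists>m. y \<in> K m" ..
      \<comment> \<open>With \<open>m\<close> minimal, the excess of \<open>\<bar>h y\<bar>\<close> over 1 is less than twice the threshold of \<open>K m\<close>.\<close>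
      define m where "m = (LEAST m. y \<in> K m)"
      have m: "y \<in> K m"
        unfolding m_def using ex by (rule LeastI_ex)
      define u where "u = (1/2 :: real) ^ m"
      have u: "0 \<le> u" "u \<le> 1"
        by (auto simp: u_def power_le_one)
      have t: "cmod (apply_bcontfun h y) \<le> 1 + 2 * e\<^sup>2 * u"
      proof (cases m)
        case 0
        then have "2 * e\<^sup>2 * u = 2 * e\<^sup>2"
          by (simp add: u_def)
        then show ?thesis
          using h1[of y] e2(1) by linarith
      next
        case (Suc n)
        then have "y \<notin> K n"
          unfolding m_def by (metis lessI not_less_Least)
        then show ?thesis
          using Suc by (simp add: K_def u_def)
      qed
      have "cmod (\<kappa> y) \<le> 1 - u / 4"
        unfolding \<kappa>_def u_def using kK[OF m] by (rule series(3))
      then have s: "cmod (of_real (1 - e) + of_real e * \<kappa> y) \<le> 1 - e * (u / 4)"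
        by (rule factor)
      show ?thesis
        unfolding Gy norm_mult using e u t norm_ge_zero s by (rule damping_estimate)
    qed
    show "apply_bcontfun G y = apply_bcontfun h y" if "y \<in> peak_set x" for y
    proof -
      have "(\<lambda>n. complex_of_real ((1/2) ^ Suc n)) sums of_real 1"
        using power_half_series by (rule sums_of_real)
      then have "\<kappa> y = 1"
        unfolding \<kappa>_def using peak_setD[OF that k] by (simp add: sums_iff)
      then show ?thesis
        by (simp add: Gy)
    qed
    show "norm (G - h) \<le> 3 * e"
    proof (rule norm_bound)
      fix y
      have "apply_bcontfun (G - h) y = of_real e * (apply_bcontfun h y * (\<kappa> y - 1))"
        by (simp add: Gy algebra_simps)
      then have "cmod (apply_bcontfun (G - h) y) = e * (cmod (apply_bcontfun h y) * cmod (\<kappa> y - 1))"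
        using e by (simp add: norm_mult)
      also have "\<dots> \<le> e * ((3/2) * 2)"
      proof (intro mult_left_mono mult_mono)
        show "cmod (apply_bcontfun h y) \<le> 3/2"
          using h1[of y] power_mono[of e "1/8" 2] e by (simp add: power2_eq_square)
        show "cmod (\<kappa> y - 1) \<le> 2"
          using norm_triangle_ineq4[of "\<kappa> y" 1] \<kappa>1[of y] by simp
      qed (use e in auto)
      finally show "cmod (apply_bcontfun (G - h) y) \<le> 3 * e"
        by simp
    qed
  qed
qed

text \<open>
  A peaking function first cuts \<open>h\<close> down to a norm close to 1, where the norm correction applies.
\<close>

lemma extension_from_peak_set:
  assumes x: "boundary_point x" and h: "h \<in> A"
    and hE: "\<And>y. y \<in> peak_set x \<Longrightarrow> cmod (apply_bcontfun h y) \<le> 1"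
  obtains G where "G \<in> A" "\<And>y. cmod (apply_bcontfun G y) \<le> 1"
    "\<And>y. y \<in> peak_set x \<Longrightarrow> apply_bcontfun G y = apply_bcontfun h y"
proof -
  define e :: real where "e = 1/8"
  have e: "0 < e" "e \<le> 1/8" "0 < e\<^sup>2"
    by (auto simp: e_def)
  define K where "K = {y. 1 + e\<^sup>2 \<le> cmod (apply_bcontfun h y)}"
  have "compact K"
    unfolding K_def using e by (intro compact_level h) (simp add: add_pos_pos)
  moreover have "K \<inter> peak_set x = {}"
  proof (rule equals0I)
    fix y assume "y \<in> K \<inter> peak_set x"
    then show False
      using hE[of y] e(3) by (simp add: K_def)
  qed
  moreover have "0 < 1 / (norm h + 1)"
    by (simp add: add_nonneg_pos)
  ultimately obtain k where k: "k \<in> face x 1" "\<And>y. y \<in> K \<Longrightarrow> cmod (apply_bcontfun k y) \<le> 1 / (norm h + 1)"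
    by (rule peaking_function[OF x]) (rule that)
  have hk: "h * k \<in> A"
    using h faceD(1)[OF k(1)] by (rule mult_mem)
  have "cmod (apply_bcontfun (h * k) y) \<le> 1 + e\<^sup>2" for y
  proof (cases "y \<in> K")
    case True
    have "cmod (apply_bcontfun h y) * cmod (apply_bcontfun k y) \<le> (norm h + 1) * (1 / (norm h + 1))"
      using norm_bounded[of h y] k(2)[OF True] by (intro mult_mono) auto
    also have "\<dots> = 1"
      by (simp add: add_nonneg_eq_0_iff)
    also have "1 \<le> 1 + e\<^sup>2"
      using e(3) by simp
    finally show ?thesis
      by (simp add: apply_simps norm_mult)
  next
    case False
    then have "cmod (apply_bcontfun h y) * cmod (apply_bcontfun k y) \<le> (1 + e\<^sup>2) * 1"
      using faceD(2)[OF k(1)] by (intro mult_mono) (auto simp: K_def)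
    then show ?thesis
      by (simp add: apply_simps norm_mult)
  qed
  moreover have hkE: "apply_bcontfun (h * k) y = apply_bcontfun h y" if "y \<in> peak_set x" for y
    using peak_setD[OF that k(1)] by (simp add: apply_simps)
  ultimately show ?thesis
    using norm_correction[OF x hk e(1,2)] hE that by metis
qed

text \<open>
  Otherwise \<open>f\<close>, divided by a value of maximal modulus on the peak set, would be bounded by 1 there, take
  the value 1 at some point \<open>w\<close> and another value at some \<open>v\<close>. Its extension to an element of the unit
  ball would belong to the face of \<open>w\<close>, which is that of \<open>x\<close>, and so would be 1 at \<open>v\<close>.
\<close>

theorem constant_on_peak_set:
  assumes x: "boundary_point x" and f: "f \<in> A" and y: "y \<in> peak_set x"
  shows "apply_bcontfun f y = apply_bcontfun f x"
proof (rule ccontr)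
  assume ne: "apply_bcontfun f y \<noteq> apply_bcontfun f x"
  obtain g where g: "g \<in> face x 1"
    by (rule boundary_point_obtains[OF x])
  have "closed (peak_set x)"
    unfolding peak_set_def Ball_def
    by (intro closed_Collect_all closed_Collect_imp closed_Collect_eq continuous_intros
        continuous_on_apply_bcontfun) auto
  moreover have "peak_set x \<subseteq> {z. 1 \<le> cmod (apply_bcontfun g z)}"
    using peak_setD[OF _ g] by auto
  ultimately have "compact (peak_set x)"
    using compact_level[OF faceD(1)[OF g], of 1]
    by (metis compact_Int_closed inf.absorb_iff2 zero_less_one)
  moreover have "continuous_on (peak_set x) (\<lambda>z. cmod (apply_bcontfun f z))"
    by (intro continuous_intros continuous_on_apply_bcontfun)
  ultimately obtain w where w: "w \<in> peak_set x"
    "\<And>z. z \<in> peak_set x \<Longrightarrow> cmod (apply_bcontfun f z) \<le> cmod (apply_bcontfun f w)"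
    using continuous_attains_sup[of "peak_set x" "\<lambda>z. cmod (apply_bcontfun f z)"] y by blast
  have w0: "apply_bcontfun f w \<noteq> 0"
  proof
    assume "apply_bcontfun f w = 0"
    then have "apply_bcontfun f z = 0" if "z \<in> peak_set x" for z
      using w(2)[OF that] by simp
    then show False
      using ne y self_in_peak_set by simp
  qed
  obtain v where v: "v \<in> peak_set x" "apply_bcontfun f v \<noteq> apply_bcontfun f w"
    using ne y self_in_peak_set by metis
  define h where "h = inverse (apply_bcontfun f w) *\<^sub>C f"
  have hz: "apply_bcontfun h z = apply_bcontfun f z / apply_bcontfun f w" for z
    by (simp add: h_def apply_simps divide_inverse)
  have hA: "h \<in> A"
    unfolding h_def by (rule scaleC_mem[OF f])
  have hE: "cmod (apply_bcontfun h z) \<le> 1" if "z \<in> peak_set x" for z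
    using w(2)[OF that] w0 by (simp add: hz norm_divide)
  obtain G where G: "G \<in> A" "\<And>z. cmod (apply_bcontfun G z) \<le> 1"
    "\<And>z. z \<in> peak_set x \<Longrightarrow> apply_bcontfun G z = apply_bcontfun h z"
    by (rule extension_from_peak_set[OF x hA hE]) (assumption | rule that)+
  have "G \<in> face w 1"
    using G w w0 by (intro faceI) (auto simp: hz)
  then have "G \<in> face x 1"
    by (simp only: peak_set_face[OF x w(1)])
  then have "apply_bcontfun G v = 1"
    by (rule peak_setD[OF v(1)])
  then show False
    using G(3)[OF v(1)] v(2) w0 by (simp add: hz)
qed

text \<open>
  The set where \<open>f\<close> is away from \<open>f x\<close> is disjoint from the peak set but need not be compact. A second
  factor \<open>g\<close> from the face takes care of the part where \<open>\<bar>g\<bar> < \<eta>\<close>, and the rest is compact.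
\<close>

lemma localized_peaking_function:
  assumes x: "boundary_point x" and f: "f \<in> A" and \<eta>: "0 < \<eta>"
  obtains k where "k \<in> face x 1"
    "\<And>y. \<eta> \<le> cmod (apply_bcontfun f y - apply_bcontfun f x) \<Longrightarrow> cmod (apply_bcontfun k y) \<le> \<eta>"
proof -
  obtain g where g: "g \<in> face x 1"
    by (rule boundary_point_obtains[OF x])
  define K where "K = {y. \<eta> \<le> cmod (apply_bcontfun g y)} \<inter> {y. \<eta> \<le> cmod (apply_bcontfun f y - apply_bcontfun f x)}"
  have "closed {y. \<eta> \<le> cmod (apply_bcontfun f y - apply_bcontfun f x)}"
    by (intro closed_Collect_le continuous_intros continuous_on_apply_bcontfun)
  then have "compact K"
    unfolding K_def using compact_level[OF faceD(1)[OF g] \<eta>] by (intro compact_Int_closed)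
  moreover have "K \<inter> peak_set x = {}"
    using constant_on_peak_set[OF x f] \<eta> by (auto simp: K_def)
  ultimately obtain k where k: "k \<in> face x 1" "\<And>y. y \<in> K \<Longrightarrow> cmod (apply_bcontfun k y) \<le> \<eta>"
    using \<eta> by (rule peaking_function[OF x]) (rule that)
  show ?thesis
  proof (rule that)
    show "k * g \<in> face x 1"
      using faceD[OF k(1)] faceD[OF g]
      by (intro faceI mult_mem) (auto simp: apply_simps norm_mult intro: mult_le_one)
    fix y assume y: "\<eta> \<le> cmod (apply_bcontfun f y - apply_bcontfun f x)"
    have le: "cmod (apply_bcontfun k y) * cmod (apply_bcontfun g y) \<le> cmod (apply_bcontfun k y)"
      "cmod (apply_bcontfun k y) * cmod (apply_bcontfun g y) \<le> cmod (apply_bcontfun g y)"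
      using faceD(2)[OF k(1), of y] faceD(2)[OF g, of y]
      by (auto intro: mult_left_le mult_left_le_one_le)
    then show "cmod (apply_bcontfun (k * g) y) \<le> \<eta>"
      using k(2)[of y] y by (cases "y \<in> K") (auto simp: K_def apply_simps norm_mult)
  qed
qed

section \<open>Distances to faces\<close>

text \<open>
  Adding \<open>t l k\<close> with a peaking function \<open>k\<close> changes the value at \<open>x\<close> as desired. Near \<open>x\<close> the modulus stays
  below \<open>\<bar>f x\<bar> + t \<le> 1\<close> up to a small error, and far from \<open>x\<close> the added term is small. The norm
  correction removes the error.
\<close>

lemma value_step:
  assumes x: "boundary_point x" and f: "f \<in> A" "\<And>y. cmod (apply_bcontfun f y) \<le> 1"
    and t: "0 \<le> t" "cmod (apply_bcontfun f x) + t \<le> 1" and l: "cmod l = 1" and \<epsilon>: "0 < \<epsilon>"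
  obtains g where "g \<in> A" "\<And>y. cmod (apply_bcontfun g y) \<le> 1"
    "apply_bcontfun g x = apply_bcontfun f x + of_real t * l" "norm (f - g) \<le> t + \<epsilon>"
proof -
  define e where "e = min (1/8) (\<epsilon> / 3)"
  have e: "0 < e" "e \<le> 1/8" "3 * e \<le> \<epsilon>"
    using \<epsilon> by (auto simp: e_def)
  have e2: "0 < e\<^sup>2"
    using e by simp
  obtain k where k: "k \<in> face x 1"
    "\<And>y. e\<^sup>2 \<le> cmod (apply_bcontfun f y - apply_bcontfun f x) \<Longrightarrow> cmod (apply_bcontfun k y) \<le> e\<^sup>2"
    by (rule localized_peaking_function[OF x f(1) e2]) (rule that)
  define h where "h = f + (of_real t * l) *\<^sub>C k"
  have hy: "apply_bcontfun h y = apply_bcontfun f y + of_real t * l * apply_bcontfun k y" for y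
    by (simp add: h_def apply_simps)
  have hA: "h \<in> A"
    unfolding h_def by (intro add_mem scaleC_mem f(1) faceD(1)[OF k(1)])
  have t1: "t \<le> 1"
    using t(2) norm_ge_zero[of "apply_bcontfun f x"] by linarith
  have bound: "cmod (apply_bcontfun h y) \<le> cmod (apply_bcontfun f y) + t * cmod (apply_bcontfun k y)" for y
    unfolding hy using t l norm_triangle_ineq[of "apply_bcontfun f y" "of_real t * l * apply_bcontfun k y"]
    by (simp add: norm_mult)
  have kt: "t * cmod (apply_bcontfun k y) \<le> t" for y
    using t(1) faceD(2)[OF k(1)] by (intro mult_right_le_one_le) auto
  have h1: "cmod (apply_bcontfun h y) \<le> 1 + e\<^sup>2" for y
  proof (cases "e\<^sup>2 \<le> cmod (apply_bcontfun f y - apply_bcontfun f x)")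
    case True
    have "t * cmod (apply_bcontfun k y) \<le> 1 * e\<^sup>2"
      using k(2)[OF True] t1 t(1) by (intro mult_mono) auto
    then show ?thesis
      using bound[of y] f(2)[of y] by linarith
  next
    case False
    then have "cmod (apply_bcontfun f y) \<le> cmod (apply_bcontfun f x) + e\<^sup>2"
      using norm_triangle_sub[of "apply_bcontfun f y" "apply_bcontfun f x"] by linarith
    then show ?thesis
      using bound[of y] kt[of y] t(2) by linarith
  qed
  have hE: "cmod (apply_bcontfun h y) \<le> 1" if "y \<in> peak_set x" for y
    using bound[of y] kt[of y] t(2) constant_on_peak_set[OF x f(1) that] by simp
  obtain G where G: "G \<in> A" "\<And>y. cmod (apply_bcontfun G y) \<le> 1"
    "\<And>y. y \<in> peak_set x \<Longrightarrow> apply_bcontfun G y = apply_bcontfun h y" "norm (G - h) \<le> 3 * e"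
    by (rule norm_correction[OF x hA e(1,2) h1 hE]) (assumption | rule that)+
  have "norm (f - G) \<le> norm (f - h) + norm (h - G)"
    using norm_triangle_ineq[of "f - h" "h - G"] by simp
  also have "norm (f - h) \<le> t"
    using kt t l by (intro norm_bound) (simp add: hy norm_mult)
  finally have "norm (f - G) \<le> t + \<epsilon>"
    using G(4) e(3) norm_minus_commute[of G h] by linarith
  moreover have "apply_bcontfun G x = apply_bcontfun f x + of_real t * l"
    using G(3)[OF self_in_peak_set] faceD(3)[OF k(1)] by (simp add: hy)
  ultimately show ?thesis
    using that G(1,2) by blast
qed

text \<open>
  In one step from \<open>r l\<close> to \<open>l\<close>, the sum \<open>r + (1 - r) k\<close> could leave the unit disc when \<open>r < 0\<close>, as the
  values of \<open>k\<close> are arbitrary in the disc. In small steps only \<open>\<bar>f x\<bar> + t \<le> 1\<close> is needed each time, which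
  is what \<open>(N + 1) t \<le> 2\<close> guarantees.
\<close>

lemma value_steps:
  assumes x: "boundary_point x" and l: "cmod l = 1" and t: "0 \<le> t"
  shows "f \<in> A \<Longrightarrow> (\<And>y. cmod (apply_bcontfun f y) \<le> 1) \<Longrightarrow>
    apply_bcontfun f x = of_real (1 - real N * t) * l \<Longrightarrow> (real N + 1) * t \<le> 2 \<Longrightarrow> 0 < \<epsilon> \<Longrightarrow>
    \<exists>g\<in>face x l. norm (f - g) \<le> real N * t + \<epsilon>"
proof (induction N arbitrary: f \<epsilon>)
  case 0
  then show ?case
    using l by (intro bexI[of _ f] faceI) auto
next
  case (Suc N)
  have "cmod (apply_bcontfun f x) = \<bar>1 - real (Suc N) * t\<bar>"
    unfolding Suc.prems(3) norm_mult norm_of_real l by simp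
  moreover have "\<bar>1 - real (Suc N) * t\<bar> + t \<le> 1"
    using Suc.prems(4) t mult_nonneg_nonneg[of "real N" t] by (simp add: abs_le_iff algebra_simps abs_if)
  ultimately have le1: "cmod (apply_bcontfun f x) + t \<le> 1"
    by simp
  have half: "0 < \<epsilon> / 2"
    using Suc.prems(5) by simp
  obtain g where g: "g \<in> A" "\<And>y. cmod (apply_bcontfun g y) \<le> 1"
    "apply_bcontfun g x = apply_bcontfun f x + of_real t * l" "norm (f - g) \<le> t + \<epsilon> / 2"
    by (rule value_step[OF x Suc.prems(1,2) t le1 l half]) (rule that)
  have "apply_bcontfun g x = of_real (1 - real N * t) * l"
    unfolding g(3) Suc.prems(3) by (simp add: algebra_simps)
  moreover have "(real N + 1) * t \<le> 2"
    using Suc.prems(4) t by (simp add: algebra_simps)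
  ultimately obtain p where p: "p \<in> face x l" "norm (g - p) \<le> real N * t + \<epsilon> / 2"
    using Suc.IH[OF g(1,2) _ _ half] by blast
  have "norm (f - p) \<le> norm (f - g) + norm (g - p)"
    using norm_triangle_ineq[of "f - g" "g - p"] by simp
  then have "norm (f - p) \<le> real (Suc N) * t + \<epsilon>"
    using g(4) p(2) by (simp add: algebra_simps)
  then show ?case
    using p(1) by blast
qed

lemma face_nonempty:
  assumes "boundary_point x" "cmod l = 1"
  obtains g where "g \<in> face x l"
proof -
  obtain g where "g \<in> face x 1"
    by (rule boundary_point_obtains[OF assms(1)])
  then have "l *\<^sub>C g \<in> face x (l * 1)"
    by (simp only: face_scaleC_iff[OF assms(2)])
  then show ?thesis
    using that by simp
qed

theorem distance_to_face:
  assumes x: "boundary_point x" and f: "f \<in> unit_sphere A"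
    and l: "cmod l = 1" and r: "- 1 \<le> r" "r \<le> 1" and fx: "apply_bcontfun f x = of_real r * l"
    and \<epsilon>: "0 < \<epsilon>"
  shows "\<exists>g\<in>face x l. norm (f - g) \<le> 1 - r + \<epsilon>"
proof (cases "r = - 1")
  case True
  obtain g where g: "g \<in> face x l"
    by (rule face_nonempty[OF x l])
  have "norm (f - g) \<le> norm f + norm g"
    by (rule norm_triangle_ineq4)
  then have "norm (f - g) \<le> 1 - r + \<epsilon>"
    using faceD(4)[OF g] f True \<epsilon> by (simp add: unit_sphere_def)
  then show ?thesis
    using g by blast
next
  case False
  then have r1: "0 < 1 + r"
    using r by simp
  \<comment> \<open>Large \<open>N\<close> makes the step length \<open>t = (1 - r) / N\<close> at most \<open>1 + r\<close>, so that \<open>(N + 1) t \<le> 2\<close>.\<close>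
  obtain N :: nat where N: "2 / (1 + r) < real N"
    using reals_Archimedean2 by blast
  have N0: "0 < real N"
    using N r1 by (meson divide_pos_pos less_trans zero_less_numeral)
  define t where "t = (1 - r) / real N"
  have t: "0 \<le> t" "real N * t = 1 - r"
    using N0 r by (auto simp: t_def)
  have "2 < real N * (1 + r)"
    using N r1 by (simp add: divide_less_eq)
  moreover have "t * real N = 1 - r"
    using t(2) by (simp add: mult.commute)
  ultimately have "t * real N \<le> (1 + r) * real N"
    using r by (simp add: mult.commute)
  then have "t \<le> 1 + r"
    using N0 by (simp add: mult_le_cancel_right)
  then have "(real N + 1) * t \<le> 2"
    using t(2) by (simp add: distrib_right)
  moreover have "f \<in> A" "\<And>y. cmod (apply_bcontfun f y) \<le> 1"
    using f norm_bounded[of f] by (auto simp: unit_sphere_def)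
  moreover have "apply_bcontfun f x = of_real (1 - real N * t) * l"
    using fx t(2) by simp
  ultimately show ?thesis
    using value_steps[OF x l t(1), of f N \<epsilon>] \<epsilon> t(2) by simp
qed

end

section \<open>Rotations of faces under an isometry\<close>

lemma fourth_root_near_1:
  assumes "cmod \<kappa> = 1"
  obtains \<rho> where "cmod \<rho> = 1" "cmod (1 - \<rho>) < 1" "\<rho> * (\<rho> * (\<rho> * \<rho>)) = \<kappa>"
proof -
  have root1: "cmod (csqrt z) = 1" if "cmod z = 1" for z
    using that by (simp add: norm_csqrt)
  define \<sigma> where "\<sigma> = csqrt \<kappa>"
  define \<rho> where "\<rho> = csqrt \<sigma>"
  have \<sigma>: "cmod \<sigma> = 1" "0 \<le> Re \<sigma>"
    using root1[OF assms] csqrt_principal[of \<kappa>] by (auto simp: \<sigma>_def)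
  have \<rho>: "cmod \<rho> = 1" "0 \<le> Re \<rho>"
    using root1[OF \<sigma>(1)] csqrt_principal[of \<sigma>] by (auto simp: \<rho>_def)
  have sq: "\<rho> * \<rho> = \<sigma>" "\<sigma> * \<sigma> = \<kappa>"
    using power2_csqrt[of \<sigma>] power2_csqrt[of \<kappa>] by (auto simp: \<rho>_def \<sigma>_def power2_eq_square)
  have "(Re \<rho>)\<^sup>2 - (Im \<rho>)\<^sup>2 = Re \<sigma>"
    unfolding sq(1)[symmetric] by (simp add: power2_eq_square)
  moreover have one: "(Re \<rho>)\<^sup>2 + (Im \<rho>)\<^sup>2 = 1"
    using \<rho>(1) cmod_power2[of \<rho>] by simp
  ultimately have "(1/2)\<^sup>2 < (Re \<rho>)\<^sup>2"
    using \<sigma>(2) by (simp add: power2_eq_square)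
  then have "1/2 < Re \<rho>"
    using \<rho>(2) by (rule power2_less_imp_less)
  moreover have "(cmod (1 - \<rho>))\<^sup>2 = (Re \<rho>)\<^sup>2 + (Im \<rho>)\<^sup>2 + 1 - 2 * Re \<rho>"
    unfolding cmod_power2 by (simp add: power2_eq_square algebra_simps)
  ultimately have "(cmod (1 - \<rho>))\<^sup>2 < 1\<^sup>2"
    using one by simp
  then have "cmod (1 - \<rho>) < 1"
    by (rule power2_less_imp_less) simp
  moreover have "\<rho> * (\<rho> * (\<rho> * \<rho>)) = \<kappa>"
    using sq by (simp add: mult.assoc[symmetric])
  ultimately show ?thesis
    using that \<rho>(1) by blast
qed

lemma Re_eq_of_dist_1_eq:
  assumes "cmod a = 1" "cmod b = 1" "cmod (a - 1) = cmod (b - 1)"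
  shows "Re a = Re b"
proof -
  have "(cmod (z - 1))\<^sup>2 = (cmod z)\<^sup>2 + 1 - 2 * Re z" for z
    unfolding cmod_power2 by (simp add: power2_eq_square algebra_simps)
  from this[of a] this[of b] show ?thesis
    using assms by simp
qed

lemma unimodular_Re_eq:
  assumes "cmod a = 1" "cmod b = 1" "Re a = Re b"
  shows "a = b \<or> a = cnj b"
proof -
  have "(Im a)\<^sup>2 = (Im b)\<^sup>2"
    using cmod_power2[of a] cmod_power2[of b] assms by simp
  then show ?thesis
    using assms by (auto simp: power2_eq_iff complex_eq_iff)
qed

locale c0_sphere_isometry = c0_algebra A
  for A :: "('y::t2_space \<Rightarrow>\<^sub>C complex) set" +
  fixes B' :: "'b::complex_normed_vector set" and T :: "('y \<Rightarrow>\<^sub>C complex) \<Rightarrow> 'b"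
  assumes B': "complex_vector.subspace B'"
    and T: "surj_isometry (unit_sphere A) (unit_sphere B') T"
begin

lemma subspace_B': "subspace B'"
  using B' by (rule complex_subspace_imp_subspace)

lemma T_dist: "f \<in> unit_sphere A \<Longrightarrow> g \<in> unit_sphere A \<Longrightarrow> norm (T f - T g) = norm (f - g)"
  using surj_isometry_dist[OF T] by (simp add: dist_norm)

lemma maximal_face_T_image:
  assumes "boundary_point x" "cmod l = 1"
  shows "maximal_face B' (T ` face x l)"
  using maximal_face_image[OF subspace subspace_B' T] maximal_face_iff_boundary_point assms by blast

text \<open>
  The pull-back of the rotated face is the face of some \<open>(y, m)\<close>. Rotation moves each vector of the
  face by \<open>\<bar>1 - \<kappa>\<bar> < 1\<close>, so the values at \<open>y\<close> of the members of the original face are within this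
  distance of \<open>m\<close>. If \<open>y\<close> were outside the peak set of \<open>x\<close>, some member would be small at \<open>y\<close>.
\<close>

lemma rotated_face_near_1:
  assumes x: "boundary_point x" and l: "cmod l = 1" and \<kappa>: "cmod \<kappa> = 1" "cmod (1 - \<kappa>) < 1"
  obtains m where "cmod m = 1" "T ` face x m = scaleC \<kappa> ` T ` face x l"
proof -
  let ?D = "scaleC \<kappa> ` T ` face x l"
  have D: "maximal_face B' ?D"
    using B' \<kappa>(1) maximal_face_T_image[OF x l] by (rule maximal_face_scaleC)
  have "maximal_face A (inv_into (unit_sphere A) T ` ?D)"
    using maximal_face_image[OF subspace_B' subspace surj_isometry_inv[OF T] D] .
  then obtain y m where m: "cmod m = 1" "inv_into (unit_sphere A) T ` ?D = face y m"
    by (rule maximal_face_eq_face)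
  have "?D \<subseteq> T ` unit_sphere A"
    using maximal_faceD(2)[OF D] surj_isometry_image[OF T] by simp
  then have TD: "T ` face y m = ?D"
    unfolding m(2)[symmetric] by (rule image_inv_into_cancel[OF refl])
  have "y \<in> peak_set x"
  proof (rule ccontr)
    assume "y \<notin> peak_set x"
    then have "{y} \<inter> peak_set x = {}" "0 < (1 - cmod (1 - \<kappa>)) / 2"
      using \<kappa> by auto
    then obtain k where k: "k \<in> face x 1" "\<And>z. z \<in> {y} \<Longrightarrow> cmod (apply_bcontfun k z) \<le> (1 - cmod (1 - \<kappa>)) / 2"
      by (rule peaking_function[OF x, of "{y}", rotated]) (auto intro: that)
    define f where "f = l *\<^sub>C k"
    have f: "f \<in> face x l"
      using face_scaleC_iff[OF l, of k x 1] k(1) by (simp add: f_def)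
    then have "\<kappa> *\<^sub>C T f \<in> T ` face y m"
      unfolding TD by blast
    then obtain g where g: "g \<in> face y m" "\<kappa> *\<^sub>C T f = T g"
      by blast
    have fS: "f \<in> unit_sphere A" "g \<in> unit_sphere A"
      using f g(1) face_subset by blast+
    then have "norm (T f) = 1"
      using surj_isometry_image[OF T] by (auto simp: unit_sphere_def)
    have "m - apply_bcontfun f y = apply_bcontfun (g - f) y"
      using faceD(3)[OF g(1)] by simp
    also have "cmod \<dots> \<le> norm (f - g)"
      using norm_bounded[of "g - f" y] by (simp add: norm_minus_commute)
    also have "\<dots> = norm (T f - \<kappa> *\<^sub>C T f)"
      using T_dist[OF fS] g(2) by simp
    also have "T f - \<kappa> *\<^sub>C T f = (1 - \<kappa>) *\<^sub>C T f"
      by (simp add: complex_vector.scale_left_diff_distrib scaleC_one)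
    also have "norm \<dots> = cmod (1 - \<kappa>)"
      using \<open>norm (T f) = 1\<close> by (simp add: norm_scaleC)
    finally have "1 - cmod (apply_bcontfun f y) \<le> cmod (1 - \<kappa>)"
      using norm_triangle_ineq2[of m "apply_bcontfun f y"] m(1) by linarith
    moreover have "cmod (apply_bcontfun f y) \<le> (1 - cmod (1 - \<kappa>)) / 2"
      using k(2)[of y] l by (simp add: f_def apply_simps norm_mult)
    ultimately have "1 - cmod (1 - \<kappa>) \<le> (1 - cmod (1 - \<kappa>)) / 2"
      by linarith
    then show False
      using \<kappa>(2) by simp
  qed
  then have "face y 1 = face x 1"
    by (rule peak_set_face[OF x])
  then have "face y m = face x m"
    using scaleC_image_face[OF m(1), of y 1] scaleC_image_face[OF m(1), of x 1] by simp
  then show ?thesis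
    using that m(1) TD by simp
qed

text \<open>
  Every rotation is the fourth power of one that moves points by less than 1.
\<close>

lemma rotated_face:
  assumes x: "boundary_point x" and \<kappa>: "cmod \<kappa> = 1"
  obtains m where "cmod m = 1" "T ` face x m = scaleC \<kappa> ` T ` face x 1"
proof -
  obtain \<rho> where \<rho>: "cmod \<rho> = 1" "cmod (1 - \<rho>) < 1" "\<rho> * (\<rho> * (\<rho> * \<rho>)) = \<kappa>"
    by (rule fourth_root_near_1[OF \<kappa>])
  note step = rotated_face_near_1[OF x _ \<rho>(1,2)]
  obtain m1 where m1: "cmod m1 = 1" "T ` face x m1 = scaleC \<rho> ` T ` face x 1"
    using step[of 1] by auto
  obtain m2 where m2: "cmod m2 = 1" "T ` face x m2 = scaleC \<rho> ` T ` face x m1"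
    using step[OF m1(1)] by blast
  obtain m3 where m3: "cmod m3 = 1" "T ` face x m3 = scaleC \<rho> ` T ` face x m2"
    using step[OF m2(1)] by blast
  obtain m4 where m4: "cmod m4 = 1" "T ` face x m4 = scaleC \<rho> ` T ` face x m3"
    using step[OF m3(1)] by blast
  have "T ` face x m4 = scaleC \<kappa> ` T ` face x 1"
    unfolding m4(2) m3(2) m2(2) m1(2) image_image scaleC_scaleC \<rho>(3) ..
  then show ?thesis
    using that m4(1) by blast
qed

lemma complex_sphere_face_image:
  assumes "boundary_point x" "cmod l = 1"
  shows "complex_sphere_face (T ` face x l)"
  using maximal_face_sphere_face[OF maximal_face_T_image[OF assms]]
  by (simp add: complex_sphere_face_def)

text \<open>
  Both inequalities compare the distance between suitable vectors of two faces with the distance of their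
  parameters: evaluation at \<open>x\<close> bounds it from below in \<open>A\<close>, the gauge does so in \<open>B'\<close>, and vectors
  that are multiples of each other attain the bound.
\<close>

lemma rotation_isometric:
  assumes x: "boundary_point x"
    and m: "cmod m = 1" "T ` face x m = scaleC \<kappa> ` T ` face x 1" and \<kappa>: "cmod \<kappa> = 1"
    and m': "cmod m' = 1" "T ` face x m' = scaleC \<kappa>' ` T ` face x 1" and \<kappa>': "cmod \<kappa>' = 1"
  shows "cmod (m - m') = cmod (\<kappa> - \<kappa>')"
proof -
  interpret D: complex_sphere_face "T ` face x 1"
    using x by (intro complex_sphere_face_image) auto
  obtain f where f: "f \<in> face x m"
    by (rule face_nonempty[OF x m(1)])
  then have "T f \<in> scaleC \<kappa> ` T ` face x 1"
    unfolding m(2)[symmetric] by blast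
  then obtain d where d: "d \<in> T ` face x 1" "T f = \<kappa> *\<^sub>C d"
    by blast
  then have "\<kappa>' *\<^sub>C d \<in> T ` face x m'"
    unfolding m'(2) by blast
  then obtain g where g: "g \<in> face x m'" "T g = \<kappa>' *\<^sub>C d"
    by (metis imageE)
  have S: "f \<in> unit_sphere A" "g \<in> unit_sphere A"
    using f g(1) face_subset by blast+
  have "m - m' = apply_bcontfun (f - g) x"
    using faceD(3)[OF f] faceD(3)[OF g(1)] by simp
  also have "cmod \<dots> \<le> norm (f - g)"
    by (rule norm_bounded)
  also have "\<dots> = norm (\<kappa> *\<^sub>C d - \<kappa>' *\<^sub>C d)"
    using T_dist[OF S] d(2) g(2) by simp
  also have "\<dots> = cmod (\<kappa> - \<kappa>')"
    using D.norm_eq_1[OF d(1)] by (simp add: norm_scaleC flip: complex_vector.scale_left_diff_distrib)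
  finally have le: "cmod (m - m') \<le> cmod (\<kappa> - \<kappa>')" .
  \<comment> \<open>The reverse inequality, from \<open>f\<close> and its multiple in the other face.\<close>
  define c where "c = m' / m"
  have m0: "m \<noteq> 0"
    using m(1) by auto
  have c: "cmod c = 1" "c * m = m'" "(1 - c) * m = m - m'"
    using m(1) m'(1) m0 by (auto simp: c_def norm_divide algebra_simps)
  have cf: "c *\<^sub>C f \<in> face x m'"
    using face_scaleC_iff[OF c(1), of f x m] f c(2) by simp
  then have "T (c *\<^sub>C f) \<in> scaleC \<kappa>' ` T ` face x 1"
    unfolding m'(2)[symmetric] by blast
  then obtain d' where d': "d' \<in> T ` face x 1" "T (c *\<^sub>C f) = \<kappa>' *\<^sub>C d'"
    by blast
  have "cmod (\<kappa> - \<kappa>') \<le> norm (\<kappa> *\<^sub>C d - \<kappa>' *\<^sub>C d')"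
    by (rule D.multiple_dist[OF d(1) d'(1)])
  also have "\<dots> = norm (T f - T (c *\<^sub>C f))"
    using d(2) d'(2) by simp
  also have "\<dots> = norm (f - c *\<^sub>C f)"
    using S(1) cf face_subset by (intro T_dist) auto
  also have "f - c *\<^sub>C f = (1 - c) *\<^sub>C f"
    by (simp add: complex_vector.scale_left_diff_distrib scaleC_one)
  also have "norm \<dots> = cmod ((1 - c) * m)"
    using faceD(4)[OF f] m(1) by (simp add: norm_scaleC norm_mult)
  finally show ?thesis
    using le c(3) by simp
qed

text \<open>
  The map \<open>\<nu>\<close> from the rotations of the image to the values at \<open>x\<close> preserves distances and fixes 1, so \<open>\<nu> \<kappa>\<close>
  is \<open>\<kappa>\<close> or its conjugate. By injectivity, \<open>w\<close> is attained at \<open>w\<close> or at its conjugate.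
\<close>

lemma face_rotation:
  assumes x: "boundary_point x" and w: "cmod w = 1"
  obtains \<kappa> where "cmod \<kappa> = 1" "Re \<kappa> = Re w"
    "T ` face x w = scaleC \<kappa> ` T ` face x 1" "T ` face x (- w) = scaleC (- \<kappa>) ` T ` face x 1"
proof -
  define \<nu> where "\<nu> \<kappa> = (SOME m. cmod m = 1 \<and> T ` face x m = scaleC \<kappa> ` T ` face x 1)" for \<kappa>
  have "cmod (\<nu> \<kappa>) = 1 \<and> T ` face x (\<nu> \<kappa>) = scaleC \<kappa> ` T ` face x 1" if \<kappa>1: "cmod \<kappa> = 1" for \<kappa>
    unfolding \<nu>_def
  proof (rule someI_ex)
    obtain m where "cmod m = 1" "T ` face x m = scaleC \<kappa> ` T ` face x 1"
      by (rule rotated_face[OF x \<kappa>1])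
    then show "\<exists>m. cmod m = 1 \<and> T ` face x m = scaleC \<kappa> ` T ` face x 1"
      by (intro exI conjI)
  qed
  then have \<nu>: "\<And>\<kappa>. cmod \<kappa> = 1 \<Longrightarrow> cmod (\<nu> \<kappa>) = 1"
    "\<And>\<kappa>. cmod \<kappa> = 1 \<Longrightarrow> T ` face x (\<nu> \<kappa>) = scaleC \<kappa> ` T ` face x 1"
    by simp_all
  have iso: "cmod (\<nu> \<kappa> - \<nu> \<kappa>') = cmod (\<kappa> - \<kappa>')" if "cmod \<kappa> = 1" "cmod \<kappa>' = 1" for \<kappa> \<kappa>'
    using rotation_isometric[OF x \<nu>[OF that(1)] that(1) \<nu>[OF that(2)] that(2)] .
  have "T ` face x 1 = scaleC 1 ` T ` face x 1"
    by (simp add: scaleC_one)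
  then have "cmod (\<nu> \<kappa> - 1) = cmod (\<kappa> - 1)" if "cmod \<kappa> = 1" for \<kappa>
    using rotation_isometric[OF x \<nu>[OF that] that, of 1 1] by simp
  then have Re: "Re (\<nu> \<kappa>) = Re \<kappa>" if "cmod \<kappa> = 1" for \<kappa>
    using that \<nu>(1)[OF that] by (intro Re_eq_of_dist_1_eq) auto
  have w': "cmod (cnj w) = 1"
    using w by simp
  have a: "\<nu> w = w \<or> \<nu> w = cnj w" "\<nu> (cnj w) = w \<or> \<nu> (cnj w) = cnj w"
    using unimodular_Re_eq[OF \<nu>(1)[OF w] w Re[OF w]]
      unimodular_Re_eq[OF \<nu>(1)[OF w'] w] Re[OF w'] by auto
  obtain \<kappa> where \<kappa>: "cmod \<kappa> = 1" "\<nu> \<kappa> = w"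
  proof (cases "\<nu> w = w")
    case True
    then show ?thesis
      using that w by blast
  next
    case False
    then have "w \<noteq> cnj w" "\<nu> w = cnj w"
      using a(1) by auto
    then have "\<nu> (cnj w) \<noteq> \<nu> w"
      using iso[OF w w'] by auto
    then have "\<nu> (cnj w) = w"
      using a(2) \<open>\<nu> w = cnj w\<close> by auto
    then show ?thesis
      using that w' by blast
  qed
  have n\<kappa>: "cmod (- \<kappa>) = 1"
    using \<kappa> by simp
  have "\<nu> (- \<kappa>) = - w"
  proof -
    have "cmod (\<nu> (- \<kappa>) - w) = 2"
      using iso[OF n\<kappa> \<kappa>(1)] \<kappa> by (simp add: norm_minus_commute norm_mult flip: mult_2)
    then have "(cmod (\<nu> (- \<kappa>) - w))\<^sup>2 = 4"
      by simp
    moreover have "(cmod (\<nu> (- \<kappa>) - w))\<^sup>2 = (cmod (\<nu> (- \<kappa>)))\<^sup>2 + (cmod w)\<^sup>2 + 2 * Re (cnj (- w) * \<nu> (- \<kappa>))"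
      unfolding cmod_power2 by (simp add: power2_eq_square algebra_simps)
    ultimately have "Re (cnj (- w) * \<nu> (- \<kappa>)) = 1"
      using \<nu>(1)[OF n\<kappa>] w by simp
    then show ?thesis
      using \<nu>(1)[OF n\<kappa>] w by (intro unimodular_eqI) auto
  qed
  then show ?thesis
    using that[OF \<kappa>(1)] Re[OF \<kappa>(1)] \<kappa>(2) \<nu>(2)[OF \<kappa>(1)] \<nu>(2)[OF n\<kappa>] by simp
qed

text \<open>
  For \<open>f x = r w\<close>, the distances of \<open>f\<close> to the faces of \<open>w\<close> and \<open>- w\<close> are \<open>1 - r\<close> and \<open>1 + r\<close>. On the other side
  these are the faces \<open>\<kappa> D\<close> and \<open>- \<kappa> D\<close>, so the conjugate of \<open>\<kappa>\<close> times \<open>T f\<close> is as close to \<open>D\<close> and \<open>- D\<close>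
  as the number \<open>r\<close> is to \<open>1\<close> and \<open>-1\<close>.
\<close>

lemma gauge_at_image:
  assumes x: "boundary_point x" and f: "f \<in> unit_sphere A"
  shows "sphere_face.gauge_at (T ` face x 1) (T f) = Re (apply_bcontfun f x)"
    and "sphere_face.gauge_at (T ` face x 1) (- T f) = - Re (apply_bcontfun f x)"
proof -
  let ?D = "T ` face x 1"
  interpret D: complex_sphere_face ?D
    using x by (intro complex_sphere_face_image) auto
  define r where "r = cmod (apply_bcontfun f x)"
  \<comment> \<open>For \<open>r = 0\<close> any unimodular \<open>w\<close> serves.\<close>
  define w where "w = (if apply_bcontfun f x = 0 then 1 else apply_bcontfun f x / of_real r)"
  have w: "cmod w = 1" "apply_bcontfun f x = of_real r * w"
    by (auto simp: w_def r_def norm_divide)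
  have r: "0 \<le> r" "r \<le> 1"
    using norm_bounded[of f x] f by (auto simp: r_def unit_sphere_def)
  obtain \<kappa> where \<kappa>: "cmod \<kappa> = 1" "Re \<kappa> = Re w"
    and faces: "T ` face x w = scaleC \<kappa> ` ?D" "T ` face x (- w) = scaleC (- \<kappa>) ` ?D"
    by (rule face_rotation[OF x w(1)])
  define c where "c = cnj \<kappa> *\<^sub>C T f"
  have \<kappa>\<kappa>: "\<kappa> * cnj \<kappa> = 1"
    using complex_norm_square[of \<kappa>] \<kappa>(1) by simp
  have \<kappa>c: "\<kappa> *\<^sub>C c = T f"
    by (simp add: c_def scaleC_scaleC \<kappa>\<kappa> scaleC_one)
  have near: "\<exists>d\<in>?D. norm (c - d) \<le> 1 - r + e" if e: "0 < e" for e
  proof -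
    obtain g where g: "g \<in> face x w" "norm (f - g) \<le> 1 - r + e"
      using distance_to_face[OF x f w(1) _ r(2) w(2) e] r(1) by auto
    then have "T g \<in> scaleC \<kappa> ` ?D"
      unfolding faces(1)[symmetric] by blast
    then obtain d where d: "d \<in> ?D" "T g = \<kappa> *\<^sub>C d"
      by blast
    have "norm (c - d) = norm (\<kappa> *\<^sub>C c - \<kappa> *\<^sub>C d)"
      using \<kappa>(1) by (simp add: norm_scaleC_diff)
    also have "\<dots> = norm (f - g)"
      unfolding \<kappa>c d(2)[symmetric] using f g(1) face_subset by (intro T_dist) auto
    finally have "norm (c - d) \<le> 1 - r + e"
      using g(2) by simp
    then show ?thesis
      using d(1) by (rule bexI)
  qed
  have far: "\<exists>d\<in>?D. norm (c + d) \<le> 1 + r + e" if e: "0 < e" for e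
  proof -
    have fx: "apply_bcontfun f x = of_real (- r) * (- w)" "cmod (- w) = 1"
      using w by auto
    obtain g where g: "g \<in> face x (- w)" "norm (f - g) \<le> 1 - (- r) + e"
      using distance_to_face[OF x f fx(2) _ _ fx(1) e] r by auto
    then have "T g \<in> scaleC (- \<kappa>) ` ?D"
      unfolding faces(2)[symmetric] by blast
    then obtain d where d: "d \<in> ?D" "T g = (- \<kappa>) *\<^sub>C d"
      by blast
    have "norm (c + d) = norm (\<kappa> *\<^sub>C (c + d))"
      using \<kappa>(1) by (simp add: norm_scaleC)
    also have "\<kappa> *\<^sub>C (c + d) = T f - T g"
      by (simp add: scaleC_add_right \<kappa>c d(2))
    also have "norm \<dots> = norm (f - g)"
      using f g(1) face_subset by (intro T_dist) auto
    finally have "norm (c + d) \<le> 1 + r + e"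
      using g(2) by simp
    then show ?thesis
      using d(1) by (rule bexI)
  qed
  have "- 1 \<le> r"
    using r(1) by simp
  note gauge = D.gauge_at_near_multiple[OF near far this r(2)]
  have fx: "Re (apply_bcontfun f x) = r * Re w"
    by (simp add: w(2))
  show "D.gauge_at (T f) = Re (apply_bcontfun f x)"
    using gauge[of \<kappa>] by (simp add: \<kappa>c fx \<kappa>(2))
  show "D.gauge_at (- T f) = - Re (apply_bcontfun f x)"
    using gauge[of "- \<kappa>"] by (simp add: \<kappa>c fx \<kappa>(2))
qed

text \<open>
  This is the previous lemma for the isometry \<open>f \<mapsto> T (l f)\<close>.
\<close>

lemma gauge_at_rotated_image:
  assumes x: "boundary_point x" and l: "cmod l = 1" and f: "f \<in> unit_sphere A"
  shows "sphere_face.gauge_at (T ` face x l) (T f) = Re (cnj l * apply_bcontfun f x)"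
    and "sphere_face.gauge_at (T ` face x l) (- T f) = - Re (cnj l * apply_bcontfun f x)"
proof -
  interpret R: c0_sphere_isometry A B' "T \<circ> scaleC l"
    using surj_isometry_comp[OF scaleC_surj_isometry[OF complex_subspace l] T] B'
    by unfold_locales
  have ll: "l * cnj l = 1"
    using complex_norm_square[of l] l by simp
  have "cnj l *\<^sub>C f \<in> unit_sphere A"
    using f l scaleC_mem by (simp add: unit_sphere_def norm_scaleC)
  moreover have "(T \<circ> scaleC l) ` face x 1 = T ` face x l"
    unfolding image_comp[symmetric] using scaleC_image_face[OF l, of x 1] by simp
  moreover have "(T \<circ> scaleC l) (cnj l *\<^sub>C f) = T f"
    by (simp add: scaleC_scaleC ll scaleC_one)
  moreover have "apply_bcontfun (cnj l *\<^sub>C f) x = cnj l * apply_bcontfun f x"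
    by (simp add: apply_simps)
  ultimately show "sphere_face.gauge_at (T ` face x l) (T f) = Re (cnj l * apply_bcontfun f x)"
    and "sphere_face.gauge_at (T ` face x l) (- T f) = - Re (cnj l * apply_bcontfun f x)"
    using R.gauge_at_image[OF x, of "cnj l *\<^sub>C f"] by simp_all
qed

section \<open>The real-linear extension\<close>

definition extension :: "('y \<Rightarrow>\<^sub>C complex) \<Rightarrow> 'b" where
  "extension f = norm f *\<^sub>R T (sgn f)"

lemma sgn_in_sphere: "f \<in> A \<Longrightarrow> f \<noteq> 0 \<Longrightarrow> sgn f \<in> unit_sphere A"
  by (simp add: unit_sphere_def norm_sgn) (simp add: sgn_div_norm scaleR_mem)

lemma T_in_sphere: "f \<in> unit_sphere A \<Longrightarrow> T f \<in> unit_sphere B'"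
  using surj_isometry_image[OF T] by blast

lemma extension_mem: "f \<in> A \<Longrightarrow> extension f \<in> B'"
  using sgn_in_sphere[of f] T_in_sphere[of "sgn f"] subspace_B'
  by (cases "f = 0") (auto simp: extension_def unit_sphere_def subspace_0 subspace_scale)

lemma norm_extension: "f \<in> A \<Longrightarrow> norm (extension f) = norm f"
  using sgn_in_sphere[of f] T_in_sphere[of "sgn f"]
  by (cases "f = 0") (auto simp: extension_def unit_sphere_def)

lemma extension_scaleR_nonneg:
  assumes "0 \<le> r"
  shows "extension (r *\<^sub>R f) = r *\<^sub>R extension f"
  using assms by (cases "r = 0") (auto simp: extension_def sgn_scaleR)

lemma extension_on_sphere: "f \<in> unit_sphere A \<Longrightarrow> extension f = T f"
  by (simp add: extension_def unit_sphere_def sgn_div_norm)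

lemma gauge_at_extension:
  assumes x: "boundary_point x" and l: "cmod l = 1" and f: "f \<in> A"
  shows "sphere_face.gauge_at (T ` face x l) (extension f) = Re (cnj l * apply_bcontfun f x)"
    and "sphere_face.gauge_at (T ` face x l) (- extension f) = - Re (cnj l * apply_bcontfun f x)"
proof -
  interpret D: complex_sphere_face "T ` face x l"
    using x l by (rule complex_sphere_face_image)
  have "D.gauge_at (extension f) = Re (cnj l * apply_bcontfun f x) \<and>
    D.gauge_at (- extension f) = - Re (cnj l * apply_bcontfun f x)"
  proof (cases "f = 0")
    case True
    then show ?thesis
      by (simp add: extension_def D.gauge_at_zero)
  next
    case False
    have "apply_bcontfun f x = norm f *\<^sub>R apply_bcontfun (sgn f) x"
      using False by (simp add: sgn_div_norm)
    then have fx: "Re (cnj l * apply_bcontfun f x) = norm f * Re (cnj l * apply_bcontfun (sgn f) x)"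
      by (simp only: mult_scaleR_right scaleR_complex.sel)
    have neg: "- extension f = norm f *\<^sub>R (- T (sgn f))"
      by (simp add: extension_def)
    show ?thesis
      unfolding neg unfolding extension_def fx
      by (simp only: D.gauge_at_scaleR[OF norm_ge_zero] gauge_at_rotated_image[OF x l sgn_in_sphere[OF f False]]
          mult_minus_right simp_thms)
  qed
  then show "D.gauge_at (extension f) = Re (cnj l * apply_bcontfun f x)"
    and "D.gauge_at (- extension f) = - Re (cnj l * apply_bcontfun f x)"
    by auto
qed

text \<open>
  The normalised vector is \<open>T f\<close> for some \<open>f\<close>, and \<open>f\<close> lies in a maximal face. The gauge of the image of
  this face is 1 at \<open>T f\<close>.
\<close>

lemma gauges_norming:
  assumes b: "b \<in> B'" "b \<noteq> 0"
  obtains x l where "boundary_point x" "cmod l = 1" "sphere_face.gauge_at (T ` face x l) b = norm b"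
proof -
  have "sgn b \<in> unit_sphere B'"
    using b subspace_B' by (auto simp: unit_sphere_def norm_sgn sgn_div_norm subspace_scale)
  then obtain f where f: "f \<in> unit_sphere A" "sgn b = T f"
    using surj_isometry_image[OF T] by blast
  have "{f} \<noteq> {}" "{f} \<subseteq> unit_sphere A" "convex {f}"
    using f by auto
  then obtain C where C: "maximal_face A C" "{f} \<subseteq> C"
    by (rule convex_subset_maximal_face)
  obtain x l where l: "cmod l = 1" "C = face x l"
    by (rule maximal_face_eq_face[OF C(1)])
  have x: "boundary_point x"
    using C(1) maximal_face_iff_boundary_point[OF l(1)] l(2) by simp
  interpret D: complex_sphere_face "T ` face x l"
    using x l(1) by (rule complex_sphere_face_image)
  have "T f \<in> T ` face x l"
    using C(2) l(2) by blast
  then have "D.gauge_at (T f) = 1"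
    using D.gauge_at_multiple[of "T f" 1] by (simp add: scaleC_one)
  moreover have "b = norm b *\<^sub>R T f"
    using b(2) by (simp add: f(2)[symmetric] sgn_div_norm)
  ultimately have "D.gauge_at b = norm b"
    using D.gauge_at_scaleR[of "norm b" "T f"] by simp
  then show ?thesis
    using that x l(1) by blast
qed

text \<open>
  No gauge is positive at the defect of additivity: by sublinearity it is at most the sum of its values at
  \<open>extension (f + g)\<close>, \<open>- extension f\<close> and \<open>- extension g\<close>, and these add up to 0. Yet if the defect were
  not 0, some gauge would take its norm as the value there.
\<close>

lemma extension_add:
  assumes f: "f \<in> A" and g: "g \<in> A"
  shows "extension (f + g) = extension f + extension g"
proof (rule ccontr)
  assume ne: "extension (f + g) \<noteq> extension f + extension g"
  define b where "b = extension (f + g) + (- extension f + - extension g)"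
  have "b \<noteq> 0"
    using ne by (auto simp: b_def algebra_simps)
  have fg: "f + g \<in> A"
    using f g by (rule add_mem)
  have "b \<in> B'"
    unfolding b_def using subspace_B' extension_mem f g fg by (intro subspace_add subspace_neg)
  then obtain x l where x: "boundary_point x" "cmod l = 1"
    and b: "sphere_face.gauge_at (T ` face x l) b = norm b"
    using \<open>b \<noteq> 0\<close> by (rule gauges_norming)
  interpret D: complex_sphere_face "T ` face x l"
    using x by (rule complex_sphere_face_image)
  have "D.gauge_at b
      \<le> D.gauge_at (extension (f + g)) + (D.gauge_at (- extension f) + D.gauge_at (- extension g))"
    unfolding b_def by (intro order_trans[OF D.gauge_at_add_le] add_left_mono D.gauge_at_add_le)
  also have "\<dots> = 0"
    using gauge_at_extension[OF x] f g fg by (simp add: distrib_left)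
  finally show False
    using b \<open>b \<noteq> 0\<close> by simp
qed

lemma extension_minus:
  assumes "f \<in> A"
  shows "extension (- f) = - extension f"
proof -
  have "- f \<in> A"
    using subspace assms by (rule subspace_neg)
  then have "extension (f + - f) = extension f + extension (- f)"
    by (rule extension_add[OF assms])
  then show ?thesis
    by (simp add: extension_def[of 0] eq_neg_iff_add_eq_0 add.commute)
qed

theorem extension_properties:
  "real_linear_on A extension" "surj_isometry A B' extension"
  "\<forall>f\<in>unit_sphere A. extension f = T f"
proof -
  show "\<forall>f\<in>unit_sphere A. extension f = T f"
    using extension_on_sphere by blast
  have scale: "extension (r *\<^sub>R f) = r *\<^sub>R extension f" if f: "f \<in> A" for r f
  proof (cases "0 \<le> r")
    case True
    then show ?thesis
      by (rule extension_scaleR_nonneg)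
  next
    case False
    then have "extension ((- r) *\<^sub>R f) = (- r) *\<^sub>R extension f"
      by (intro extension_scaleR_nonneg) simp
    then show ?thesis
      using extension_minus[OF scaleR_mem[OF f, of r]] by simp
  qed
  then show "real_linear_on A extension"
    by (simp add: real_linear_on_def extension_add)
  show "surj_isometry A B' extension"
    unfolding surj_isometry_def
  proof (intro conjI ballI)
    have "b \<in> extension ` A" if b: "b \<in> B'" for b
    proof (cases "b = 0")
      case True
      then show ?thesis
        using zero_mem by (intro image_eqI[of _ _ 0]) (auto simp: extension_def)
    next
      case False
      have "sgn b \<in> unit_sphere B'"
        using b False subspace_B' by (auto simp: unit_sphere_def norm_sgn sgn_div_norm subspace_scale)
      then obtain f where f: "f \<in> unit_sphere A" "sgn b = T f"
        using surj_isometry_image[OF T] by blast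
      have "b = norm b *\<^sub>R T f"
        using False by (simp add: f(2)[symmetric] sgn_div_norm)
      also have "\<dots> = extension (norm b *\<^sub>R f)"
        by (simp add: extension_scaleR_nonneg extension_on_sphere[OF f(1)])
      finally show ?thesis
        using f(1) by (auto simp: unit_sphere_def scaleR_mem)
    qed
    then show "extension ` A = B'"
      using extension_mem by blast
    fix f g assume f: "f \<in> A" and g: "g \<in> A"
    then have fg: "f - g \<in> A"
      using subspace by (intro subspace_diff)
    have "extension ((f - g) + g) = extension (f - g) + extension g"
      using fg g by (rule extension_add)
    then have "extension f - extension g = extension (f - g)"
      by simp
    then show "dist (extension f) (extension g) = dist f g"
      using norm_extension[OF fg] by (simp add: dist_norm)
  qed
qed

end

theorem (in c0_algebra) complex_mazur_ulam: "complex_mazur_ulam TYPE('b::complex_normed_vector) A"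
  unfolding complex_mazur_ulam_def
proof (intro conjI allI impI)
  show "complex_banach_space A"
    using complex_subspace complete_closed_bcontfun[OF closed_A] by (simp add: complex_banach_space_def)
  fix B' :: "'b set" and T
  assume "complex_banach_space B'" and T: "surj_isometry (unit_sphere A) (unit_sphere B') T"
  then interpret c0_sphere_isometry A B' T
    by unfold_locales (auto simp: complex_banach_space_def)
  show "\<exists>U. real_linear_on A U \<and> surj_isometry A B' U \<and> (\<forall>x\<in>unit_sphere A. U x = T x)"
    using extension_properties by blast
qed

lemma uniform_algebra_c0_algebra:
  assumes "uniform_algebra A"
  shows "c0_algebra A"
proof
  have cpt: "compact (UNIV :: 'a set)"
    using assms by (simp add: uniform_algebra_def)
  have "compact {y. e \<le> cmod (apply_bcontfun f y)}" for e and f :: "'a \<Rightarrow>\<^sub>C complex"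
  proof -
    have "closed {y. e \<le> cmod (apply_bcontfun f y)}"
      by (intro closed_Collect_le continuous_intros continuous_on_apply_bcontfun)
    then show ?thesis
      using compact_Int_closed[OF cpt] by simp
  qed
  then show "A \<subseteq> C0"
    by (auto simp: C0_def)
  show "complex_subalgebra A" "closed A"
    using assms by (simp_all add: uniform_algebra_def)
qed

theorem corollary6p5:
  shows "(locally_compact_space (euclidean :: 'y::t2_space topology) \<longrightarrow>
            (\<forall>A :: ('y \<Rightarrow>\<^sub>C complex) set.
               A \<subseteq> C0 \<longrightarrow> complex_subalgebra A \<longrightarrow> closed A \<longrightarrow> A \<noteq> {0} \<longrightarrow>
               complex_mazur_ulam TYPE('b::complex_normed_vector) A)) \<and>
         (\<forall>A :: ('x::t2_space \<Rightarrow>\<^sub>C complex) set.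
            uniform_algebra A \<longrightarrow> complex_mazur_ulam TYPE('b) A)"
proof (intro conjI impI allI)
  fix A :: "('y \<Rightarrow>\<^sub>C complex) set"
  assume "A \<subseteq> C0" "complex_subalgebra A" "closed A"
  then show "complex_mazur_ulam TYPE('b) A"
    by (intro c0_algebra.complex_mazur_ulam c0_algebra.intro)
next
  fix A :: "('x \<Rightarrow>\<^sub>C complex) set"
  assume "uniform_algebra A"
  then show "complex_mazur_ulam TYPE('b) A"
    by (intro c0_algebra.complex_mazur_ulam uniform_algebra_c0_algebra)
qed

end
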